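(* Let $\mathcal I$ be a nonempty index set, let $\mathbf A$ be a locally finite quantifier theory with equality, and for each $i\in\mathcal I$ let $\mathbf B_i$ be a normal $2$-model of $\mathbf A$. Let $\mathbf B$ be the modification of $\mathbf A$ with $\mathbf B_*(\emptyset)=\prod_{i\in\mathcal I}2$ and $\mathbf B^*(\emptyset)=\prod_{i\in\mathcal I}\mathbf B_i^*(\emptyset)$, such that for nonempty $X\in\mathcal S$, $a\in\mathbf A^*(X)$, $p\in\mathbf A_*(X)$ and $\sigma:X\to\mathbf B^*(\emptyset)$ one has $(a\sigma)(i)=a\sigma_i$ and $(p\sigma)(i)=p\sigma_i$, where $\sigma_i(x)=\sigma(x)(i)$. Let $I$ be an ultrafilter of $\mathbf B_*(\emptyset)=\prod_{i\in\mathcal I}2$, and let $\theta$ be the equivalence relation on $(\mathbf B/I)^*(\emptyset)=\prod_{i\in\mathcal I}\mathbf B_i^*(\emptyset)$ given by $a\,\theta\,b$ iff $e(a,b)=1$ in $(\mathbf B/I)_*(\emptyset)=(\prod_{i\in\mathcal I}2)/I$. Then $(\mathbf B/I)/\theta$ is a normal $2$-model of $\mathbf A$.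
   Context: Throughout, $\mathcal S$ is a nonempty collection of sets containing at least one infinite set; $X,Y,Z,W$ denote members of $\mathcal S$ (sets of variables). Quantifier theory. A quantifier theory $\mathbf A$ over $\mathcal S$ consists of: a set $\mathbf A^*(X)$ and a map $\epsilon_X:X\to\mathbf A^*(X)$ for each $X$ (one writes $x$ for $\epsilon_X(x)$); a Boolean algebra $\mathbf A_*(X)$ for each $X$; an element $a\sigma\in\mathbf A^*(Y)$ for each nonempty $X$, $a\in\mathbf A^*(X)$ and map $\sigma:X\to\mathbf A^*(Y)$; an element $p\sigma\in\mathbf A_*(Y)$ for each nonempty $X$, $p\in\mathbf A_*(X)$ and map $\sigma:X\to\mathbf A^*(Y)$; an element $\forall x.p\in\mathbf A_*(X)$ for each nonempty $X$, $x\in X$, $p\in\mathbf A_*(X)$. Put $\mathbf A(X)=\mathbf A_*(X)\cup\mathbf A^*(X)$. For all nonempty $X$, $x\in X$, $t\in\mathbf A(X)$, $\sigma:X\to\mathbf A^*(Y)$, $p,q\in\mathbf A_*(X)$ the following hold. (P1) $t\epsilon_X=t$. (P2) $(t\sigma)\tau=t(\sigma\tau)$ if $Y$ is nonempty and $\tau:Y\to\mathbf A^*(W)$, where $(\sigma\tau)(x)=\sigma(x)\tau$. (P3) $x\sigma=\sigma(x)$. (P4) $p\mapsto p\sigma$ is a homomorphism of Boolean algebras $\mathbf A_*(X)\to\mathbf A_*(Y)$. (P5) $(\forall x.p)\sigma=\forall y.(p\sigma^{y/x})$ whenever $y,z\in Y$, $y\ne z$ and $\sigma[z/y]=\sigma$.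 (Q1) $\forall x.(p\wedge q)=\forall x.p\wedge\forall x.q$. (Q2) $\forall x.p\le p$. (Q3) $\forall x.p=p$ if $p[y/x]=p$ for some $y\in X$, $y\neq x$. Notation: for $y\in Y$ and $d\in\mathbf A^*(Y)$, $[d/y]:Y\to\mathbf A^*(Y)$ sends $y$ to $d$ and every other variable to itself; for $d\in \mathbf A^*(Y)$, $\sigma^{d/x}:X\to\mathbf A^*(Y)$ sends $x$ to $d$ and agrees with $\sigma$ elsewhere. Supports. For nonempty $X$ and $t\in\mathbf A(X)$, a subset $U\subseteq X$ is a support for $t$ if $t\sigma=t\tau$ for all $Y$ and all $\sigma,\tau:X\to\mathbf A^*(Y)$ with $\sigma|_U=\tau|_U$; $t$ is closed if $\emptyset$ is a support for $t$ (elements of $\mathbf A(\emptyset)$ are by definition closed). $\mathbf A$ is locally finite if every element of every $\mathbf A(X)$ has a finite support. Standing convention: every quantifier theory considered is nontrivial, meaning that $\mathbf A_*(X)$ has a non-closed element for some nonempty $X\in\mathcal S$. Equality. An equality $e$ of $\mathbf A$ consists of an element $e(a,b)\in\mathbf A_*(X)$ for all $X$ and $a,b\in\mathbf A^*(X)$ such that (E1) $e(a,b)\sigma=e(a\sigma,b\sigma)$ for $X$ nonempty, $\sigma:X\to\mathbf A^*(Y)$; (E2) $e(a,a)=1$; (E3) $p\wedge e(x,y)\le p[x/y]$ for $x,y\in X$, $p\in\mathbf A_*(X)$. A quantifier theory with equality is a quantifier theory together with an equality. Models. A quantifier model is a quantifier theory $\mathbf B$ over a collection containing $\emptyset$ such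 that (M1) $\mathbf B^*(\emptyset)\neq\emptyset$ and $\mathbf B_*(\emptyset)$ is a nontrivial Boolean algebra ($0\ne1$); (M2) for nonempty $X$, $x\in X$, $p\in\mathbf B_*(X)$, $\sigma:X\to\mathbf B^*(\emptyset)$, the infimum $\bigwedge_{d\in\mathbf B^*(\emptyset)}p\sigma^{d/x}$ exists in $\mathbf B_*(\emptyset)$ and equals $(\forall x.p)\sigma$. It is a $2$-model if $\mathbf B_*(\emptyset)=2=\{0,1\}$. A modification (resp. model, $2$-model) of $\mathbf A$ is a quantifier theory (resp. quantifier model, $2$-model) over $\mathcal S\cup\{\emptyset\}$ whose restriction to $\mathcal S\setminus\{\emptyset\}$ equals that of $\mathbf A$ (including the equality when $\mathbf A$ has one). A quantifier model with equality is normal if (M3) for $a,b\in\mathbf B^*(\emptyset)$, $e(a,a)=1$ and $e(a,b)=0$ if $a\neq b$. Quotients. For a filter $I$ of $\mathbf B_*(\emptyset)$, $\mathbf B/I$ agrees with $\mathbf B$ except that its Boolean algebra at $\emptyset$ is $\mathbf B_*(\emptyset)/I$, with $p\sigma$ replaced by its class; for an ultrafilter the quotient is identified with $2$. In the claim, the equality of $\mathbf B$ at $\emptyset$ is $e(a,b)(i)=e(a(i),b(i))$, and that of $\mathbf B/I$ is its class modulo $I$. For a $2$-model $\mathbf C$ of $\mathbf A$ with equality and $a\,\theta\,b\iff e(a,b)=1$ on $\mathbf C^*(\emptyset)$, $\mathbf C/\theta$ is the modification of $\mathbf A$ with $(\mathbf C/\theta)_*(\emptyset)=\mathbf C_*(\emptyset)$,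 $(\mathbf C/\theta)^*(\emptyset)=\mathbf C^*(\emptyset)/\theta$, where for $\bar\sigma:X\to\mathbf C^*(\emptyset)/\theta$ and any lift $\sigma:X\to\mathbf C^*(\emptyset)$ of $\bar\sigma$ one sets $p\bar\sigma=p\sigma$ and $a\bar\sigma=$ the class of $a\sigma$ (these do not depend on the lift), and $e$ of two classes is $e$ of representatives. *)

theory Defs
  imports "HOL-Library.FuncSet" "HOL-Algebra.Congruence"
begin

section \<open>Boolean algebras with an explicit carrier\<close>

record 'p balg = "'p partial_object" +
  bmeet :: "'p \<Rightarrow> 'p \<Rightarrow> 'p"
  bjoin :: "'p \<Rightarrow> 'p \<Rightarrow> 'p"
  bcompl :: "'p \<Rightarrow> 'p"
  bzero :: 'p
  bone :: 'p

text \<open>The one-element algebra is allowed.\<close>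

locale boolean_algebra_on =
  fixes L :: "'p balg"
  assumes meet_closed: "p \<in> carrier L \<Longrightarrow> q \<in> carrier L \<Longrightarrow> bmeet L p q \<in> carrier L"
    and join_closed: "p \<in> carrier L \<Longrightarrow> q \<in> carrier L \<Longrightarrow> bjoin L p q \<in> carrier L"
    and compl_closed: "p \<in> carrier L \<Longrightarrow> bcompl L p \<in> carrier L"
    and zero_closed: "bzero L \<in> carrier L"
    and one_closed: "bone L \<in> carrier L"
    and meet_comm: "p \<in> carrier L \<Longrightarrow> q \<in> carrier L \<Longrightarrow> bmeet L p q = bmeet L q p"
    and join_comm: "p \<in> carrier L \<Longrightarrow> q \<in> carrier L \<Longrightarrow> bjoin L p q = bjoin L q p"
    and meet_join_distrib: "p \<in> carrier L \<Longrightarrow> q \<in> carrier L \<Longrightarrow> r \<in> carrier L \<Longrightarrow>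
          bmeet L p (bjoin L q r) = bjoin L (bmeet L p q) (bmeet L p r)"
    and join_meet_distrib: "p \<in> carrier L \<Longrightarrow> q \<in> carrier L \<Longrightarrow> r \<in> carrier L \<Longrightarrow>
          bjoin L p (bmeet L q r) = bmeet L (bjoin L p q) (bjoin L p r)"
    and meet_one: "p \<in> carrier L \<Longrightarrow> bmeet L p (bone L) = p"
    and join_zero: "p \<in> carrier L \<Longrightarrow> bjoin L p (bzero L) = p"
    and meet_compl: "p \<in> carrier L \<Longrightarrow> bmeet L p (bcompl L p) = bzero L"
    and join_compl: "p \<in> carrier L \<Longrightarrow> bjoin L p (bcompl L p) = bone L"

definition ble :: "'p balg \<Rightarrow> 'p \<Rightarrow> 'p \<Rightarrow> bool" where
  "ble L p q \<longleftrightarrow> bmeet L p q = p"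

definition is_infimum :: "'p balg \<Rightarrow> 'p set \<Rightarrow> 'p \<Rightarrow> bool" where
  "is_infimum L D m \<longleftrightarrow> m \<in> carrier L \<and> (\<forall>p\<in>D. ble L m p) \<and>
     (\<forall>l\<in>carrier L. (\<forall>p\<in>D. ble L l p) \<longrightarrow> ble L l m)"

definition boolean_hom :: "'p balg \<Rightarrow> 'q balg \<Rightarrow> ('p \<Rightarrow> 'q) \<Rightarrow> bool" where
  "boolean_hom L M h \<longleftrightarrow>
     h \<in> carrier L \<rightarrow> carrier M \<and>
     (\<forall>p\<in>carrier L. \<forall>q\<in>carrier L. h (bmeet L p q) = bmeet M (h p) (h q)) \<and>
     (\<forall>p\<in>carrier L. \<forall>q\<in>carrier L. h (bjoin L p q) = bjoin M (h p) (h q)) \<and>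
     (\<forall>p\<in>carrier L. h (bcompl L p) = bcompl M (h p)) \<and>
     h (bzero L) = bzero M \<and> h (bone L) = bone M"

text \<open>Equality as Boolean algebras: values outside the carrier are irrelevant.\<close>

definition same_balg :: "'p balg \<Rightarrow> 'p balg \<Rightarrow> bool" where
  "same_balg L M \<longleftrightarrow>
     carrier L = carrier M \<and>
     (\<forall>p\<in>carrier L. \<forall>q\<in>carrier L. bmeet L p q = bmeet M p q) \<and>
     (\<forall>p\<in>carrier L. \<forall>q\<in>carrier L. bjoin L p q = bjoin M p q) \<and>
     (\<forall>p\<in>carrier L. bcompl L p = bcompl M p) \<and>
     bzero L = bzero M \<and> bone L = bone M"

definition product_balg :: "'i set \<Rightarrow> ('i \<Rightarrow> 'q balg) \<Rightarrow> ('i \<Rightarrow> 'q) balg" where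
  "product_balg J L =
     \<lparr>carrier = (\<Pi>\<^sub>E i\<in>J. carrier (L i)),
      bmeet = (\<lambda>p q. \<lambda>i\<in>J. bmeet (L i) (p i) (q i)),
      bjoin = (\<lambda>p q. \<lambda>i\<in>J. bjoin (L i) (p i) (q i)),
      bcompl = (\<lambda>p. \<lambda>i\<in>J. bcompl (L i) (p i)),
      bzero = (\<lambda>i\<in>J. bzero (L i)),
      bone = (\<lambda>i\<in>J. bone (L i))\<rparr>"

definition is_filter_of :: "'p balg \<Rightarrow> 'p set \<Rightarrow> bool" where
  "is_filter_of L I \<longleftrightarrow>
     I \<subseteq> carrier L \<and> bone L \<in> I \<and>
     (\<forall>p\<in>I. \<forall>q\<in>I. bmeet L p q \<in> I) \<and>
     (\<forall>p\<in>I. \<forall>q\<in>carrier L. ble L p q \<longrightarrow> q \<in> I)"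

text \<open>A filter is proper if it is not the whole algebra; an ultrafilter is a maximal proper filter.\<close>

definition is_ultrafilter_of :: "'p balg \<Rightarrow> 'p set \<Rightarrow> bool" where
  "is_ultrafilter_of L I \<longleftrightarrow>
     is_filter_of L I \<and> I \<noteq> carrier L \<and>
     (\<forall>F. is_filter_of L F \<and> F \<noteq> carrier L \<and> I \<subseteq> F \<longrightarrow> F = I)"

definition filter_rel :: "'p balg \<Rightarrow> 'p set \<Rightarrow> ('p \<times> 'p) set" where
  "filter_rel L I =
     {(p, q). p \<in> carrier L \<and> q \<in> carrier L \<and>
        bmeet L (bjoin L (bcompl L p) q) (bjoin L (bcompl L q) p) \<in> I}"

text \<open>The operations on classes are given by representatives; since they respect
  \<^const>\<open>filter_rel\<close>, the unions below are unions of copies of a single class.\<close>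

definition quotient_balg :: "'p balg \<Rightarrow> 'p set \<Rightarrow> 'p set balg" where
  "quotient_balg L I =
     \<lparr>carrier = carrier L // filter_rel L I,
      bmeet = (\<lambda>P Q. \<Union>p\<in>P. \<Union>q\<in>Q. filter_rel L I `` {bmeet L p q}),
      bjoin = (\<lambda>P Q. \<Union>p\<in>P. \<Union>q\<in>Q. filter_rel L I `` {bjoin L p q}),
      bcompl = (\<lambda>P. \<Union>p\<in>P. filter_rel L I `` {bcompl L p}),
      bzero = filter_rel L I `` {bzero L},
      bone = filter_rel L I `` {bone L}\<rparr>"


section \<open>Quantifier theories\<close>

text \<open>Models change the data at the empty set only, and products and quotients change its type.
  So the data at the empty set get types \<open>'b\<close>, \<open>'q\<close> of their own, while the data at all nonempty
  sets of variables live in types \<open>'a\<close>, \<open>'p\<close>.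

  The fibre at \<open>Y\<close> collects the set of terms, the Boolean algebra of propositions, the
  equality \<open>e(_, _)\<close>, and the substitutions \<open>a\<sigma>\<close>, \<open>p\<sigma>\<close> along maps \<open>\<sigma>\<close> from a set of variables \<open>X\<close>
  (the first argument of \<open>tsub\<close>, \<open>psub\<close>) into the terms of the fibre. Maps defined on \<open>X\<close> are
  represented by extensional functions.\<close>

record ('v, 'a, 'p, 'b, 'q) fibre =
  terms :: "'b set"
  props :: "'q balg"
  tsub :: "'v set \<Rightarrow> 'a \<Rightarrow> ('v \<Rightarrow> 'b) \<Rightarrow> 'b"
  psub :: "'v set \<Rightarrow> 'p \<Rightarrow> ('v \<Rightarrow> 'b) \<Rightarrow> 'q"
  eql :: "'b \<Rightarrow> 'b \<Rightarrow> 'q"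

text \<open>\<open>fib A Y\<close> is meaningful for nonempty \<open>Y\<close> only; the fibre at the empty set is \<open>fib0 A\<close>.
  The map \<open>\<epsilon>\<^sub>X\<close> is \<open>vr A X\<close>, and \<open>\<forall>x. p\<close> at \<open>X\<close> is \<open>allq A X x p\<close>.\<close>

record ('v, 'a, 'p, 'b, 'q) qtheory =
  fib :: "'v set \<Rightarrow> ('v, 'a, 'p, 'a, 'p) fibre"
  fib0 :: "('v, 'a, 'p, 'b, 'q) fibre"
  vr :: "'v set \<Rightarrow> 'v \<Rightarrow> 'a"
  allq :: "'v set \<Rightarrow> 'v \<Rightarrow> 'p \<Rightarrow> 'p"

abbreviation Tm :: "('v, 'a, 'p, 'b, 'q) qtheory \<Rightarrow> 'v set \<Rightarrow> 'a set" where
  "Tm A X \<equiv> terms (fib A X)"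

abbreviation Pr :: "('v, 'a, 'p, 'b, 'q) qtheory \<Rightarrow> 'v set \<Rightarrow> 'p balg" where
  "Pr A X \<equiv> props (fib A X)"

text \<open>The composite \<open>\<sigma>\<tau>\<close> of \<open>\<sigma>\<close> from \<open>X\<close> to the terms over \<open>Y\<close> and \<open>\<tau>\<close> from \<open>Y\<close> to the terms of
  \<open>F\<close>, and the map \<open>[d/y]\<close> on \<open>Y\<close>.\<close>

definition scomp ::
  "('v, 'a, 'p, 'b, 'q) fibre \<Rightarrow> 'v set \<Rightarrow> 'v set \<Rightarrow> ('v \<Rightarrow> 'a) \<Rightarrow> ('v \<Rightarrow> 'b) \<Rightarrow> 'v \<Rightarrow> 'b" where
  "scomp F X Y \<sigma> \<tau> = (\<lambda>x\<in>X. tsub F Y (\<sigma> x) \<tau>)"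

definition subst_one :: "('v, 'a, 'p, 'b, 'q) qtheory \<Rightarrow> 'v set \<Rightarrow> 'a \<Rightarrow> 'v \<Rightarrow> 'v \<Rightarrow> 'a" where
  "subst_one A Y d y = (vr A Y)(y := d)"

text \<open>The axioms on substitution into a fibre \<open>F\<close>, which is used both for the
  fibres at nonempty sets and for the fibre at the empty set.\<close>

locale substitution_target =
  fixes S :: "'v set set"
    and A :: "('v, 'a, 'p, 'b, 'q) qtheory"
    and F :: "('v, 'a, 'p, 'c, 'r) fibre"
  assumes props_boolean: "boolean_algebra_on (props F)"
    and tsub_closed: "X \<in> S \<Longrightarrow> X \<noteq> {} \<Longrightarrow> a \<in> Tm A X \<Longrightarrow> \<sigma> \<in> X \<rightarrow>\<^sub>E terms F \<Longrightarrow>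
          tsub F X a \<sigma> \<in> terms F"
    and P2_terms: "X \<in> S \<Longrightarrow> X \<noteq> {} \<Longrightarrow> Y \<in> S \<Longrightarrow> Y \<noteq> {} \<Longrightarrow> a \<in> Tm A X \<Longrightarrow>
          \<rho> \<in> X \<rightarrow>\<^sub>E Tm A Y \<Longrightarrow> \<tau> \<in> Y \<rightarrow>\<^sub>E terms F \<Longrightarrow>
          tsub F Y (tsub (fib A Y) X a \<rho>) \<tau> = tsub F X a (scomp F X Y \<rho> \<tau>)"
    and P2_props: "X \<in> S \<Longrightarrow> X \<noteq> {} \<Longrightarrow> Y \<in> S \<Longrightarrow> Y \<noteq> {} \<Longrightarrow> p \<in> carrier (Pr A X) \<Longrightarrow>
          \<rho> \<in> X \<rightarrow>\<^sub>E Tm A Y \<Longrightarrow> \<tau> \<in> Y \<rightarrow>\<^sub>E terms F \<Longrightarrow>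
          psub F Y (psub (fib A Y) X p \<rho>) \<tau> = psub F X p (scomp F X Y \<rho> \<tau>)"
    and P3: "X \<in> S \<Longrightarrow> x \<in> X \<Longrightarrow> \<sigma> \<in> X \<rightarrow>\<^sub>E terms F \<Longrightarrow> tsub F X (vr A X x) \<sigma> = \<sigma> x"
    and P4: "X \<in> S \<Longrightarrow> X \<noteq> {} \<Longrightarrow> \<sigma> \<in> X \<rightarrow>\<^sub>E terms F \<Longrightarrow>
          boolean_hom (Pr A X) (props F) (\<lambda>p. psub F X p \<sigma>)"

text \<open>Supports, for elements over a nonempty \<open>X\<close>. Elements over the empty set
  are closed by convention.\<close>

definition supports_term_in ::
  "('v, 'a, 'p, 'b, 'q) fibre \<Rightarrow> 'v set \<Rightarrow> 'v set \<Rightarrow> 'a \<Rightarrow> bool" where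
  "supports_term_in F X U a \<longleftrightarrow>
     (\<forall>\<sigma>\<in>X \<rightarrow>\<^sub>E terms F. \<forall>\<tau>\<in>X \<rightarrow>\<^sub>E terms F.
        (\<forall>x\<in>U. \<sigma> x = \<tau> x) \<longrightarrow> tsub F X a \<sigma> = tsub F X a \<tau>)"

definition supports_prop_in ::
  "('v, 'a, 'p, 'b, 'q) fibre \<Rightarrow> 'v set \<Rightarrow> 'v set \<Rightarrow> 'p \<Rightarrow> bool" where
  "supports_prop_in F X U p \<longleftrightarrow>
     (\<forall>\<sigma>\<in>X \<rightarrow>\<^sub>E terms F. \<forall>\<tau>\<in>X \<rightarrow>\<^sub>E terms F.
        (\<forall>x\<in>U. \<sigma> x = \<tau> x) \<longrightarrow> psub F X p \<sigma> = psub F X p \<tau>)"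

definition term_support ::
  "'v set set \<Rightarrow> ('v, 'a, 'p, 'b, 'q) qtheory \<Rightarrow> 'v set \<Rightarrow> 'v set \<Rightarrow> 'a \<Rightarrow> bool" where
  "term_support S A X U a \<longleftrightarrow>
     U \<subseteq> X \<and> (\<forall>Y\<in>S. Y \<noteq> {} \<longrightarrow> supports_term_in (fib A Y) X U a) \<and>
     ({} \<in> S \<longrightarrow> supports_term_in (fib0 A) X U a)"

definition prop_support ::
  "'v set set \<Rightarrow> ('v, 'a, 'p, 'b, 'q) qtheory \<Rightarrow> 'v set \<Rightarrow> 'v set \<Rightarrow> 'p \<Rightarrow> bool" where
  "prop_support S A X U p \<longleftrightarrow>
     U \<subseteq> X \<and> (\<forall>Y\<in>S. Y \<noteq> {} \<longrightarrow> supports_prop_in (fib A Y) X U p) \<and>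
     ({} \<in> S \<longrightarrow> supports_prop_in (fib0 A) X U p)"

definition locally_finite :: "'v set set \<Rightarrow> ('v, 'a, 'p, 'b, 'q) qtheory \<Rightarrow> bool" where
  "locally_finite S A \<longleftrightarrow>
     (\<forall>X\<in>S. X \<noteq> {} \<longrightarrow>
        (\<forall>a\<in>Tm A X. \<exists>U. finite U \<and> term_support S A X U a) \<and>
        (\<forall>p\<in>carrier (Pr A X). \<exists>U. finite U \<and> prop_support S A X U p))"

text \<open>The last axiom is the standing convention that quantifier theories are nontrivial.\<close>

locale quantifier_theory =
  fixes S :: "'v set set"
    and A :: "('v, 'a, 'p, 'b, 'q) qtheory"
  assumes infinite_vars: "\<exists>X\<in>S. infinite X"
    and vr_closed: "X \<in> S \<Longrightarrow> X \<noteq> {} \<Longrightarrow> vr A X \<in> X \<rightarrow>\<^sub>E Tm A X"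
    and allq_closed: "X \<in> S \<Longrightarrow> x \<in> X \<Longrightarrow> p \<in> carrier (Pr A X) \<Longrightarrow> allq A X x p \<in> carrier (Pr A X)"
    and target: "Y \<in> S \<Longrightarrow> Y \<noteq> {} \<Longrightarrow> substitution_target S A (fib A Y)"
    and target0: "{} \<in> S \<Longrightarrow> substitution_target S A (fib0 A)"
    and P1_terms: "X \<in> S \<Longrightarrow> X \<noteq> {} \<Longrightarrow> a \<in> Tm A X \<Longrightarrow> tsub (fib A X) X a (vr A X) = a"
    and P1_props: "X \<in> S \<Longrightarrow> X \<noteq> {} \<Longrightarrow> p \<in> carrier (Pr A X) \<Longrightarrow> psub (fib A X) X p (vr A X) = p"
    and P5: "X \<in> S \<Longrightarrow> x \<in> X \<Longrightarrow> p \<in> carrier (Pr A X) \<Longrightarrow> Y \<in> S \<Longrightarrow> \<sigma> \<in> X \<rightarrow>\<^sub>E Tm A Y \<Longrightarrow>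
          y \<in> Y \<Longrightarrow> z \<in> Y \<Longrightarrow> y \<noteq> z \<Longrightarrow>
          scomp (fib A Y) X Y \<sigma> (subst_one A Y (vr A Y z) y) = \<sigma> \<Longrightarrow>
          psub (fib A Y) X (allq A X x p) \<sigma> =
            allq A Y y (psub (fib A Y) X p (\<sigma>(x := vr A Y y)))"
    and Q1: "X \<in> S \<Longrightarrow> x \<in> X \<Longrightarrow> p \<in> carrier (Pr A X) \<Longrightarrow> q \<in> carrier (Pr A X) \<Longrightarrow>
          allq A X x (bmeet (Pr A X) p q) = bmeet (Pr A X) (allq A X x p) (allq A X x q)"
    and Q2: "X \<in> S \<Longrightarrow> x \<in> X \<Longrightarrow> p \<in> carrier (Pr A X) \<Longrightarrow> ble (Pr A X) (allq A X x p) p"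
    and Q3: "X \<in> S \<Longrightarrow> x \<in> X \<Longrightarrow> p \<in> carrier (Pr A X) \<Longrightarrow> y \<in> X \<Longrightarrow> y \<noteq> x \<Longrightarrow>
          psub (fib A X) X p (subst_one A X (vr A X y) x) = p \<Longrightarrow> allq A X x p = p"
    and nontrivial: "\<exists>X\<in>S. X \<noteq> {} \<and> (\<exists>p\<in>carrier (Pr A X). \<not> prop_support S A X {} p)"

locale equality_target =
  fixes S :: "'v set set"
    and A :: "('v, 'a, 'p, 'b, 'q) qtheory"
    and F :: "('v, 'a, 'p, 'c, 'r) fibre"
  assumes eql_closed: "c \<in> terms F \<Longrightarrow> d \<in> terms F \<Longrightarrow> eql F c d \<in> carrier (props F)"
    and E1: "X \<in> S \<Longrightarrow> X \<noteq> {} \<Longrightarrow> a \<in> Tm A X \<Longrightarrow> b \<in> Tm A X \<Longrightarrow> \<sigma> \<in> X \<rightarrow>\<^sub>E terms F \<Longrightarrow>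
          psub F X (eql (fib A X) a b) \<sigma> = eql F (tsub F X a \<sigma>) (tsub F X b \<sigma>)"
    and E2: "c \<in> terms F \<Longrightarrow> eql F c c = bone (props F)"

locale quantifier_theory_with_equality = quantifier_theory S A
  for S :: "'v set set" and A :: "('v, 'a, 'p, 'b, 'q) qtheory" +
  assumes eq_target: "Y \<in> S \<Longrightarrow> Y \<noteq> {} \<Longrightarrow> equality_target S A (fib A Y)"
    and eq_target0: "{} \<in> S \<Longrightarrow> equality_target S A (fib0 A)"
    and E3: "X \<in> S \<Longrightarrow> x \<in> X \<Longrightarrow> y \<in> X \<Longrightarrow> p \<in> carrier (Pr A X) \<Longrightarrow>
          ble (Pr A X) (bmeet (Pr A X) p (eql (fib A X) (vr A X x) (vr A X y)))
            (psub (fib A X) X p (subst_one A X (vr A X x) y))"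


section \<open>Models\<close>

text \<open>Equality of the restrictions to the nonempty sets in \<open>S\<close>, including the equality predicate;
  again values outside the carriers are irrelevant.\<close>

definition same_restriction ::
  "'v set set \<Rightarrow> ('v, 'a, 'p, 'b, 'q) qtheory \<Rightarrow> ('v, 'a, 'p, 'c, 'r) qtheory \<Rightarrow> bool" where
  "same_restriction S A B \<longleftrightarrow>
     (\<forall>X\<in>S - {{}}.
        Tm B X = Tm A X \<and> same_balg (Pr B X) (Pr A X) \<and>
        (\<forall>x\<in>X. vr B X x = vr A X x) \<and>
        (\<forall>x\<in>X. \<forall>p\<in>carrier (Pr A X). allq B X x p = allq A X x p) \<and>
        (\<forall>a\<in>Tm A X. \<forall>b\<in>Tm A X. eql (fib B X) a b = eql (fib A X) a b) \<and>
        (\<forall>Y\<in>S - {{}}. \<forall>\<sigma>\<in>X \<rightarrow>\<^sub>E Tm A Y.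
           (\<forall>a\<in>Tm A X. tsub (fib B Y) X a \<sigma> = tsub (fib A Y) X a \<sigma>) \<and>
           (\<forall>p\<in>carrier (Pr A X). psub (fib B Y) X p \<sigma> = psub (fib A Y) X p \<sigma>)))"

text \<open>Modifications of a quantifier theory with equality.\<close>

definition modification ::
  "'v set set \<Rightarrow> ('v, 'a, 'p, 'b, 'q) qtheory \<Rightarrow> ('v, 'a, 'p, 'c, 'r) qtheory \<Rightarrow> bool" where
  "modification S A B \<longleftrightarrow>
     quantifier_theory_with_equality (insert {} S) B \<and> same_restriction S A B"

locale quantifier_model = quantifier_theory S B
  for S :: "'v set set" and B :: "('v, 'a, 'p, 'b, 'q) qtheory" +
  assumes empty_mem: "{} \<in> S"
    and M1_terms: "terms (fib0 B) \<noteq> {}"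
    and M1_props: "bzero (props (fib0 B)) \<noteq> bone (props (fib0 B))"
    and M2: "X \<in> S \<Longrightarrow> x \<in> X \<Longrightarrow> p \<in> carrier (Pr B X) \<Longrightarrow> \<sigma> \<in> X \<rightarrow>\<^sub>E terms (fib0 B) \<Longrightarrow>
          is_infimum (props (fib0 B))
            ((\<lambda>d. psub (fib0 B) X p (\<sigma>(x := d))) ` terms (fib0 B))
            (psub (fib0 B) X (allq B X x p) \<sigma>)"

text \<open>Being the algebra \<open>2\<close> means having exactly the elements \<open>0\<close> and \<open>1\<close> (distinct by M1), so
  that the quotient of a Boolean algebra by an ultrafilter is itself an instance.\<close>

locale two_model = quantifier_model S B
  for S :: "'v set set" and B :: "('v, 'a, 'p, 'b, 'q) qtheory" +
  assumes two_valued: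
    "carrier (props (fib0 B)) = {bzero (props (fib0 B)), bone (props (fib0 B))}"

definition is_normal :: "('v, 'a, 'p, 'b, 'q) qtheory \<Rightarrow> bool" where
  "is_normal B \<longleftrightarrow>
     (\<forall>a\<in>terms (fib0 B). \<forall>b\<in>terms (fib0 B).
        eql (fib0 B) a a = bone (props (fib0 B)) \<and>
        (a \<noteq> b \<longrightarrow> eql (fib0 B) a b = bzero (props (fib0 B))))"

definition normal_two_model_of ::
  "'v set set \<Rightarrow> ('v, 'a, 'p, 'b, 'q) qtheory \<Rightarrow> ('v, 'a, 'p, 'c, 'r) qtheory \<Rightarrow> bool" where
  "normal_two_model_of S A B \<longleftrightarrow>
     modification S A B \<and> two_model (insert {} S) B \<and> is_normal B"


section \<open>Products and quotients\<close>

text \<open>\<open>A\<close> with its data at the empty set replaced.\<close>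

definition with_fib0 ::
  "('v, 'a, 'p, 'b, 'q) qtheory \<Rightarrow> ('v, 'a, 'p, 'c, 'r) fibre \<Rightarrow> ('v, 'a, 'p, 'c, 'r) qtheory" where
  "with_fib0 A F = \<lparr>fib = fib A, fib0 = F, vr = vr A, allq = allq A\<rparr>"

text \<open>For \<open>\<sigma>\<close> from \<open>X\<close> into the product, \<open>\<sigma>\<^sub>i\<close> is \<open>\<lambda>x\<in>X. \<sigma> x i\<close>.\<close>

definition product_modification ::
  "('v, 'a, 'p, 'b, 'q) qtheory \<Rightarrow> 'i set \<Rightarrow> ('i \<Rightarrow> ('v, 'a, 'p, 'd, 'r) qtheory) \<Rightarrow>
     ('v, 'a, 'p, 'i \<Rightarrow> 'd, 'i \<Rightarrow> 'r) qtheory" where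
  "product_modification A J B = with_fib0 A
     \<lparr>terms = (\<Pi>\<^sub>E i\<in>J. terms (fib0 (B i))),
      props = product_balg J (\<lambda>i. props (fib0 (B i))),
      tsub = (\<lambda>X a \<sigma>. \<lambda>i\<in>J. tsub (fib0 (B i)) X a (\<lambda>x\<in>X. \<sigma> x i)),
      psub = (\<lambda>X p \<sigma>. \<lambda>i\<in>J. psub (fib0 (B i)) X p (\<lambda>x\<in>X. \<sigma> x i)),
      eql = (\<lambda>a b. \<lambda>i\<in>J. eql (fib0 (B i)) (a i) (b i))\<rparr>"

definition filter_quotient ::
  "('v, 'a, 'p, 'b, 'q) qtheory \<Rightarrow> 'q set \<Rightarrow> ('v, 'a, 'p, 'b, 'q set) qtheory" where
  "filter_quotient B I = with_fib0 B
     \<lparr>terms = terms (fib0 B),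
      props = quotient_balg (props (fib0 B)) I,
      tsub = tsub (fib0 B),
      psub = (\<lambda>X p \<sigma>. filter_rel (props (fib0 B)) I `` {psub (fib0 B) X p \<sigma>}),
      eql = (\<lambda>a b. filter_rel (props (fib0 B)) I `` {eql (fib0 B) a b})\<rparr>"

definition eq_rel :: "('v, 'a, 'p, 'b, 'q) qtheory \<Rightarrow> ('b \<times> 'b) set" where
  "eq_rel C = {(a, b). a \<in> terms (fib0 C) \<and> b \<in> terms (fib0 C) \<and>
                 eql (fib0 C) a b = bone (props (fib0 C))}"

text \<open>The lifts of a map \<open>s\<close> from \<open>X\<close> to the classes are the elements of \<open>Pi\<^sub>E X s\<close>. Each
  description below denotes the common value for all lifts or representatives, so it is
  determined only because that value does not depend on them.\<close>

definition equality_quotient ::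
  "('v, 'a, 'p, 'b, 'q) qtheory \<Rightarrow> ('v, 'a, 'p, 'b set, 'q) qtheory" where
  "equality_quotient C = with_fib0 C
     \<lparr>terms = terms (fib0 C) // eq_rel C,
      props = props (fib0 C),
      tsub = (\<lambda>X a s. THE c. \<forall>\<sigma>\<in>Pi\<^sub>E X s. eq_rel C `` {tsub (fib0 C) X a \<sigma>} = c),
      psub = (\<lambda>X p s. THE q. \<forall>\<sigma>\<in>Pi\<^sub>E X s. psub (fib0 C) X p \<sigma> = q),
      eql = (\<lambda>P Q. THE q. \<forall>a\<in>P. \<forall>b\<in>Q. eql (fib0 C) a b = q)\<rparr>"

end

theory Submission
  imports Defs
begin

text \<open>A proposition holds in \<open>B/I\<close> iff the set of indices at which it holds belongs to \<open>I\<close>. Since an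
  element over \<open>X\<close> has a finite support and \<open>I\<close> is closed under finite intersections, two
  substitutions that agree modulo \<open>\<theta>\<close> give values that agree on an index set in \<open>I\<close>, so \<open>\<theta>\<close> is a
  congruence. Choosing in each factor an element at which the value of \<open>\<forall>x. p\<close> is attained (possible
  because the factors are two-valued) shows that the infimum is attained in the product, and an
  attained infimum survives both quotients.\<close>

section \<open>Ultrafilters of Boolean algebras\<close>

text \<open>All constructions change only the data at the empty set. So each of them is checked as a
  fibre over the unchanged \<open>A\<close> (\<open>substitution_target\<close>,
  \<open>equality_target\<close>), and a whole theory is put together only once, from the final
  fibre. Supports are an obstacle: they are defined by the fibres of \<open>A\<close>, while the
  congruence argument substitutes into the factors at the empty set, which are not fibres of
  \<open>A\<close>. Finite supports therefore have to be carried over to arbitrary fibres. Index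
  sets occur only through elements of the product algebra: \<open>m\<close> stands for the set of
  those \<open>i\<close> at which \<open>m i\<close> is one. The infimum must be attained before
  passing to classes because the class map of an ultrafilter preserves finite meets and the order,
  but in general not infinite meets.\<close>

context boolean_algebra_on
begin

lemmas closed = meet_closed join_closed compl_closed zero_closed one_closed

lemma zero_join: "p \<in> carrier L \<Longrightarrow> bjoin L (bzero L) p = p"
  using join_comm join_zero zero_closed by simp

lemma one_meet: "p \<in> carrier L \<Longrightarrow> bmeet L (bone L) p = p"
  using meet_comm meet_one one_closed by simp

lemma meet_zero:
  assumes "p \<in> carrier L"
  shows "bmeet L p (bzero L) = bzero L"
proof -
  have "bmeet L p (bzero L) = bjoin L (bmeet L p (bcompl L p)) (bmeet L p (bzero L))"
    using assms by (simp add: closed meet_compl zero_join)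
  also have "\<dots> = bmeet L p (bjoin L (bcompl L p) (bzero L))"
    using assms by (simp add: closed meet_join_distrib)
  also have "\<dots> = bzero L"
    using assms by (simp add: closed join_zero meet_compl)
  finally show ?thesis .
qed

lemma zero_meet: "p \<in> carrier L \<Longrightarrow> bmeet L (bzero L) p = bzero L"
  using meet_comm meet_zero zero_closed by simp

lemma join_one:
  assumes "p \<in> carrier L"
  shows "bjoin L p (bone L) = bone L"
proof -
  have "bjoin L p (bone L) = bmeet L (bjoin L p (bcompl L p)) (bjoin L p (bone L))"
    using assms by (simp add: closed join_compl one_meet)
  also have "\<dots> = bjoin L p (bmeet L (bcompl L p) (bone L))"
    using assms by (simp add: closed join_meet_distrib)
  also have "\<dots> = bone L"
    using assms by (simp add: closed meet_one join_compl)
  finally show ?thesis .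
qed

lemma meet_compl_join:
  assumes "p \<in> carrier L" "q \<in> carrier L"
  shows "bmeet L p (bjoin L (bcompl L p) q) = bmeet L p q"
  using assms by (simp add: closed meet_join_distrib meet_compl zero_join)

text \<open>Associativity is not among the axioms of \<open>boolean_algebra_on\<close>, so the
  argument goes through the complement: inside a meet with \<open>p\<close>, joining
  \<open>bcompl L p\<close> changes nothing, and there it cancels the inner
  \<open>p\<close>.\<close>

lemma meet_left_idem:
  assumes "p \<in> carrier L" "q \<in> carrier L"
  shows "bmeet L p (bmeet L p q) = bmeet L p q"
proof -
  have "bmeet L p (bmeet L p q) = bmeet L p (bjoin L (bcompl L p) (bmeet L p q))"
    using assms by (simp add: closed meet_compl_join)
  also have "\<dots> = bmeet L p (bjoin L (bcompl L p) q)"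
    using assms
    by (simp add: closed join_meet_distrib join_comm[of "bcompl L p" p] join_compl one_meet)
  finally show ?thesis
    using assms by (simp add: meet_compl_join)
qed

lemma meet_idem: "p \<in> carrier L \<Longrightarrow> bmeet L p p = p"
  using meet_left_idem[of p "bone L"] by (simp add: closed meet_one)

text \<open>An element and its double complement both equal the meet of the two.\<close>

lemma compl_compl:
  assumes "p \<in> carrier L"
  shows "bcompl L (bcompl L p) = p"
proof -
  let ?q = "bcompl L p"
  have "bcompl L ?q = bmeet L (bcompl L ?q) (bjoin L p ?q)"
    using assms by (simp add: closed join_compl meet_one)
  also have "\<dots> = bmeet L p (bcompl L ?q)"
    using assms
    by (simp add: closed meet_join_distrib meet_comm[of "bcompl L ?q"] meet_compl join_zero)
  also have "\<dots> = bmeet L p (bjoin L ?q (bcompl L ?q))"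
    using assms by (simp add: closed meet_compl_join)
  also have "\<dots> = p"
    using assms by (simp add: closed join_compl meet_one)
  finally show ?thesis .
qed

lemma ble_refl: "p \<in> carrier L \<Longrightarrow> ble L p p"
  by (simp add: ble_def meet_idem)

lemma ble_zero: "p \<in> carrier L \<Longrightarrow> ble L (bzero L) p"
  by (simp add: ble_def zero_meet)

lemma ble_meet_left: "p \<in> carrier L \<Longrightarrow> q \<in> carrier L \<Longrightarrow> ble L (bmeet L p q) p"
  by (simp add: ble_def closed meet_left_idem meet_comm[of "bmeet L p q"])

lemma ble_meet_right: "p \<in> carrier L \<Longrightarrow> q \<in> carrier L \<Longrightarrow> ble L (bmeet L p q) q"
  using ble_meet_left[of q p] by (simp add: meet_comm)

lemma ble_join_left:
  assumes "p \<in> carrier L" "q \<in> carrier L"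
  shows "ble L p (bjoin L p q)"
proof -
  have "bmeet L p (bjoin L p q) = bmeet L (bjoin L p (bzero L)) (bjoin L p q)"
    using assms by (simp add: closed join_zero)
  also have "\<dots> = bjoin L p (bmeet L (bzero L) q)"
    using assms by (simp add: closed flip: join_meet_distrib)
  also have "\<dots> = p"
    using assms by (simp add: join_zero zero_meet)
  finally show ?thesis by (simp add: ble_def)
qed

lemma ble_join_right: "p \<in> carrier L \<Longrightarrow> q \<in> carrier L \<Longrightarrow> ble L q (bjoin L p q)"
  using ble_join_left[of q p] by (simp add: join_comm)

lemma ble_join_mono:
  assumes "p \<in> carrier L" "q \<in> carrier L" "r \<in> carrier L" "ble L q r"
  shows "ble L (bjoin L p q) (bjoin L p r)"
  using assms by (simp add: ble_def flip: join_meet_distrib)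

text \<open>A lower bound that belongs to the set is above every other lower bound. This is how the
  infimum in the final quotient is obtained, where only the order is under control.\<close>

lemma is_infimum_attained:
  "\<lbrakk>m \<in> carrier L; m \<in> D; \<And>p. p \<in> D \<Longrightarrow> ble L m p\<rbrakk> \<Longrightarrow> is_infimum L D m"
  by (auto simp: is_infimum_def)

lemma one_ble_iff: "p \<in> carrier L \<Longrightarrow> ble L (bone L) p \<longleftrightarrow> p = bone L"
  by (auto simp: ble_def one_meet)

lemma meet_eq_oneD:
  assumes "p \<in> carrier L" "q \<in> carrier L" "bmeet L p q = bone L"
  shows "p = bone L" and "q = bone L"
  using assms ble_meet_left[of p q] ble_meet_right[of p q] by (simp_all add: one_ble_iff)

text \<open>Either zero occurs in \<open>D\<close> and is the infimum, or \<open>D\<close> contains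
  only one. Two-valuedness matters: two distinct atoms of a larger algebra have an infimum, zero,
  that is neither of them. Nonemptiness excludes the empty set, whose infimum is one.\<close>

lemma two_valued_infimum_attained:
  assumes two: "carrier L = {bzero L, bone L}" "bzero L \<noteq> bone L"
    and D: "D \<subseteq> carrier L" "D \<noteq> {}" and m: "is_infimum L D m"
  shows "m \<in> D"
proof (cases "bzero L \<in> D")
  case True
  then have "ble L m (bzero L)" "m \<in> carrier L"
    using m by (auto simp: is_infimum_def)
  then have "m = bzero L"
    by (simp add: ble_def meet_zero)
  with True show ?thesis by simp
next
  case False
  then have "D = {bone L}"
    using two D by auto
  moreover from this have "ble L (bone L) m" "m \<in> carrier L"
    using m by (auto simp: is_infimum_def closed ble_refl)
  ultimately show ?thesis
    by (simp add: one_ble_iff)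
qed

end

locale ultrafilter_on = boolean_algebra_on L for L :: "'p balg" +
  fixes I :: "'p set"
  assumes ultrafilter: "is_ultrafilter_of L I"
begin

lemma filter: "is_filter_of L I"
  using ultrafilter by (simp add: is_ultrafilter_of_def)

lemma mem_carrier: "p \<in> I \<Longrightarrow> p \<in> carrier L"
  and one_mem: "bone L \<in> I"
  and meet_mem: "p \<in> I \<Longrightarrow> q \<in> I \<Longrightarrow> bmeet L p q \<in> I"
  and upward: "p \<in> I \<Longrightarrow> q \<in> carrier L \<Longrightarrow> ble L p q \<Longrightarrow> q \<in> I"
  using filter by (auto simp: is_filter_of_def)

lemma zero_not_mem: "bzero L \<notin> I"
proof
  assume "bzero L \<in> I"
  then have "I = carrier L"
    using ble_zero upward mem_carrier by blast
  then show False
    using ultrafilter by (simp add: is_ultrafilter_of_def)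
qed

lemma meet_mem_iff:
  "p \<in> carrier L \<Longrightarrow> q \<in> carrier L \<Longrightarrow> bmeet L p q \<in> I \<longleftrightarrow> p \<in> I \<and> q \<in> I"
  by (meson ble_meet_left ble_meet_right meet_mem upward)

text \<open>This is where maximality enters: if neither \<open>p\<close> nor its complement were in
  \<open>I\<close>, adjoining \<open>p\<close> would give a larger filter that is still
  proper.\<close>

lemma compl_mem_iff:
  assumes p: "p \<in> carrier L"
  shows "bcompl L p \<in> I \<longleftrightarrow> p \<notin> I"
proof
  assume "bcompl L p \<in> I"
  then show "p \<notin> I"
    using p meet_mem[of p "bcompl L p"] zero_not_mem by (auto simp: meet_compl)
next
  assume "p \<notin> I"
  show "bcompl L p \<in> I"
  proof (rule ccontr)
    assume c: "bcompl L p \<notin> I"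
    \<comment> \<open>\<open>F\<close> is the filter generated by \<open>I\<close> and \<open>p\<close>; in this form it is meet-closed by distributivity
      alone.\<close>
    define F where "F = {q \<in> carrier L. bjoin L (bcompl L p) q \<in> I}"
    have "is_filter_of L F"
      unfolding is_filter_of_def
    proof (intro conjI ballI impI)
      show "bone L \<in> F"
        using p by (simp add: F_def closed join_one one_mem)
    next
      fix q r assume "q \<in> F" "r \<in> F"
      then show "bmeet L q r \<in> F"
        using p by (simp add: F_def closed join_meet_distrib meet_mem)
    next
      fix q r assume "q \<in> F" and r: "r \<in> carrier L" "ble L q r"
      then have q: "q \<in> carrier L" "bjoin L (bcompl L p) q \<in> I"
        by (simp_all add: F_def)
      have "bjoin L (bcompl L p) r \<in> I"
        using p q(1) r by (intro upward[OF q(2)] ble_join_mono closed)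
      with r(1) show "r \<in> F"
        by (simp add: F_def)
    qed (auto simp: F_def)
    moreover have "I \<subseteq> F"
      using p by (auto simp: F_def closed mem_carrier ble_join_right
          intro: upward[of _ "bjoin L (bcompl L p) _"])
    moreover have "bzero L \<notin> F"
      using c p by (simp add: F_def closed join_zero)
    ultimately have "F = I"
      using ultrafilter zero_closed unfolding is_ultrafilter_of_def by blast
    moreover have "p \<in> F"
      using p by (simp add: F_def closed join_comm[of "bcompl L p"] join_compl one_mem)
    ultimately show False
      using \<open>p \<notin> I\<close> by simp
  qed
qed

text \<open>Primeness: meeting the join with the complement of the missing half leaves the other
  half.\<close>

lemma join_mem_iff:
  assumes "p \<in> carrier L" "q \<in> carrier L"
  shows "bjoin L p q \<in> I \<longleftrightarrow> p \<in> I \<or> q \<in> I"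
proof
  assume j: "bjoin L p q \<in> I"
  show "p \<in> I \<or> q \<in> I"
  proof (rule disjCI)
    assume "q \<notin> I"
    then have "bmeet L (bcompl L q) (bjoin L p q) \<in> I"
      using assms j by (simp add: compl_mem_iff meet_mem)
    also have "bmeet L (bcompl L q) (bjoin L p q) = bmeet L (bcompl L q) p"
      using assms meet_compl_join[of "bcompl L q" p]
      by (simp add: closed compl_compl join_comm[of p])
    finally show "p \<in> I"
      using assms by (simp add: closed meet_mem_iff)
  qed
next
  assume "p \<in> I \<or> q \<in> I"
  then show "bjoin L p q \<in> I"
    using assms ble_join_left ble_join_right upward join_closed by meson
qed

text \<open>Membership in \<open>I\<close> commutes with all Boolean operations, so the
  biconditional of \<open>p\<close> and \<open>q\<close> lies in \<open>I\<close> exactly when both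
  or neither do. From here on, computing with classes means deciding membership in
  \<open>I\<close>.\<close>

lemma filter_rel_iff:
  "(p, q) \<in> filter_rel L I \<longleftrightarrow> p \<in> carrier L \<and> q \<in> carrier L \<and> (p \<in> I \<longleftrightarrow> q \<in> I)"
  by (auto simp: filter_rel_def closed meet_mem_iff join_mem_iff compl_mem_iff)

lemma filter_class_eq_iff:
  assumes "p \<in> carrier L" "q \<in> carrier L"
  shows "filter_rel L I `` {p} = filter_rel L I `` {q} \<longleftrightarrow> (p \<in> I \<longleftrightarrow> q \<in> I)"
  using assms by (auto simp: set_eq_iff filter_rel_iff)

lemma filter_class_self: "p \<in> carrier L \<Longrightarrow> p \<in> filter_rel L I `` {p}"
  by (simp add: filter_rel_iff)

lemma filter_class_eq_one_iff:
  "p \<in> carrier L \<Longrightarrow> filter_rel L I `` {p} = bone (quotient_balg L I) \<longleftrightarrow> p \<in> I"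
  by (simp add: quotient_balg_def filter_class_eq_iff closed one_mem)

lemma filter_class_eq_zero_iff:
  "p \<in> carrier L \<Longrightarrow> filter_rel L I `` {p} = bzero (quotient_balg L I) \<longleftrightarrow> p \<notin> I"
  by (simp add: quotient_balg_def filter_class_eq_iff closed zero_not_mem)

text \<open>The operation is a union over all pairs of representatives. It collapses because each
  pair contributes the same class, and the union is nonempty because every class contains its own
  representative.\<close>

lemma filter_class_meet:
  assumes "p \<in> carrier L" "q \<in> carrier L"
  shows "bmeet (quotient_balg L I) (filter_rel L I `` {p}) (filter_rel L I `` {q}) =
    filter_rel L I `` {bmeet L p q}"
proof -
  have eq: "filter_rel L I `` {bmeet L p' q'} = filter_rel L I `` {bmeet L p q}"
    if "p' \<in> filter_rel L I `` {p}" "q' \<in> filter_rel L I `` {q}" for p' q'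
    using that by (auto simp: filter_rel_iff filter_class_eq_iff closed meet_mem_iff)
  show ?thesis
    unfolding quotient_balg_def balg.simps
    by (intro UN_constant_eq[OF filter_class_self] ballI assms eq)
qed

lemma filter_class_join:
  assumes "p \<in> carrier L" "q \<in> carrier L"
  shows "bjoin (quotient_balg L I) (filter_rel L I `` {p}) (filter_rel L I `` {q}) =
    filter_rel L I `` {bjoin L p q}"
proof -
  have eq: "filter_rel L I `` {bjoin L p' q'} = filter_rel L I `` {bjoin L p q}"
    if "p' \<in> filter_rel L I `` {p}" "q' \<in> filter_rel L I `` {q}" for p' q'
    using that by (auto simp: filter_rel_iff filter_class_eq_iff closed join_mem_iff)
  show ?thesis
    unfolding quotient_balg_def balg.simps
    by (intro UN_constant_eq[OF filter_class_self] ballI assms eq)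
qed

lemma filter_class_compl:
  assumes "p \<in> carrier L"
  shows "bcompl (quotient_balg L I) (filter_rel L I `` {p}) = filter_rel L I `` {bcompl L p}"
proof -
  have eq: "filter_rel L I `` {bcompl L p'} = filter_rel L I `` {bcompl L p}"
    if "p' \<in> filter_rel L I `` {p}" for p'
    using that by (auto simp: filter_rel_iff filter_class_eq_iff closed compl_mem_iff)
  show ?thesis
    unfolding quotient_balg_def balg.simps
    by (intro UN_constant_eq[OF filter_class_self] ballI assms eq)
qed

lemma filter_class_closed: "p \<in> carrier L \<Longrightarrow> filter_rel L I `` {p} \<in> carrier (quotient_balg L I)"
  by (simp add: quotient_balg_def quotientI)

lemma filter_class_hom: "boolean_hom L (quotient_balg L I) (\<lambda>p. filter_rel L I `` {p})"
  by (auto simp: boolean_hom_def filter_class_closed filter_class_meet filter_class_join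
      filter_class_compl) (simp_all add: quotient_balg_def)

lemma quotient_carrierE:
  assumes "P \<in> carrier (quotient_balg L I)"
  obtains p where "p \<in> carrier L" "P = filter_rel L I `` {p}"
  using assms by (auto simp: quotient_balg_def elim: quotientE)

lemma quotient_two_valued:
  "carrier (quotient_balg L I) = {bzero (quotient_balg L I), bone (quotient_balg L I)}"
proof
  show "carrier (quotient_balg L I) \<subseteq> {bzero (quotient_balg L I), bone (quotient_balg L I)}"
  proof
    fix P assume "P \<in> carrier (quotient_balg L I)"
    then obtain p where "p \<in> carrier L" "P = filter_rel L I `` {p}"
      by (rule quotient_carrierE)
    then show "P \<in> {bzero (quotient_balg L I), bone (quotient_balg L I)}"
      by (cases "p \<in> I") (simp_all add: filter_class_eq_one_iff filter_class_eq_zero_iff)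
  qed
  show "{bzero (quotient_balg L I), bone (quotient_balg L I)} \<subseteq> carrier (quotient_balg L I)"
    by (simp add: quotient_balg_def quotientI closed)
qed

lemma quotient_zero_neq_one: "bzero (quotient_balg L I) \<noteq> bone (quotient_balg L I)"
  by (simp add: quotient_balg_def filter_class_eq_iff closed zero_not_mem one_mem)

text \<open>Every element is a class and the class map commutes with the operations, so the
  identities are inherited from \<open>L\<close>.\<close>

lemma quotient_boolean_algebra: "boolean_algebra_on (quotient_balg L I)"
proof -
  have zo: "bzero (quotient_balg L I) = filter_rel L I `` {bzero L}"
    "bone (quotient_balg L I) = filter_rel L I `` {bone L}"
    by (simp_all add: quotient_balg_def)
  show ?thesis
  proof
    fix P Q
    assume "P \<in> carrier (quotient_balg L I)" "Q \<in> carrier (quotient_balg L I)"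
    then obtain p q where pq: "p \<in> carrier L" "q \<in> carrier L"
      "P = filter_rel L I `` {p}" "Q = filter_rel L I `` {q}"
      by (elim quotient_carrierE) blast
    then show "bmeet (quotient_balg L I) P Q = bmeet (quotient_balg L I) Q P"
      and "bjoin (quotient_balg L I) P Q = bjoin (quotient_balg L I) Q P"
      by (simp_all add: filter_class_meet filter_class_join meet_comm[of p] join_comm[of p])
    fix R
    assume "R \<in> carrier (quotient_balg L I)"
    then obtain r where "r \<in> carrier L" "R = filter_rel L I `` {r}"
      by (elim quotient_carrierE) blast
    with pq show "bmeet (quotient_balg L I) P (bjoin (quotient_balg L I) Q R) =
        bjoin (quotient_balg L I) (bmeet (quotient_balg L I) P Q) (bmeet (quotient_balg L I) P R)"
      and "bjoin (quotient_balg L I) P (bmeet (quotient_balg L I) Q R) =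
        bmeet (quotient_balg L I) (bjoin (quotient_balg L I) P Q) (bjoin (quotient_balg L I) P R)"
      by (simp_all add: filter_class_meet filter_class_join closed meet_join_distrib[of p]
          join_meet_distrib[of p])
  qed (auto elim!: quotient_carrierE simp: zo filter_class_closed filter_class_meet
      filter_class_join filter_class_compl closed meet_one join_zero meet_compl join_compl)
qed

end


section \<open>Homomorphisms and products of Boolean algebras\<close>

lemma boolean_hom_ble:
  assumes "boolean_hom L M h" "p \<in> carrier L" "q \<in> carrier L" "ble L p q"
  shows "ble M (h p) (h q)"
  using assms unfolding boolean_hom_def ble_def by metis

lemma boolean_hom_comp:
  assumes "boolean_hom K L g" "boolean_hom L M h"
  shows "boolean_hom K M (\<lambda>p. h (g p))"
proof -
  have "g p \<in> carrier L" if "p \<in> carrier K" for p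
    using assms(1) that by (auto simp: boolean_hom_def)
  with assms show ?thesis
    by (auto simp: boolean_hom_def Pi_iff)
qed

text \<open>A modification has the same algebras as \<open>A\<close> only up to values outside the
  carriers, so homomorphisms must be transported. Closure of the carrier under the operations lets
  \<open>h\<close> be compared at composite elements.\<close>

lemma boolean_hom_same_domain:
  assumes hom: "boolean_hom L M h" and "boolean_algebra_on L" and "same_balg L K"
  shows "boolean_hom K M h"
proof -
  interpret boolean_algebra_on L by fact
  show ?thesis
    using hom \<open>same_balg L K\<close> closed unfolding boolean_hom_def same_balg_def by metis
qed

lemma product_boolean_algebra:
  assumes "\<And>i. i \<in> J \<Longrightarrow> boolean_algebra_on (L i)"
  shows "boolean_algebra_on (product_balg J L)"
proof -
  note * = assms[THEN boolean_algebra_on.meet_closed] assms[THEN boolean_algebra_on.join_closed]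
    assms[THEN boolean_algebra_on.compl_closed] assms[THEN boolean_algebra_on.zero_closed]
    assms[THEN boolean_algebra_on.one_closed]
  note ** = assms[THEN boolean_algebra_on.meet_one] assms[THEN boolean_algebra_on.join_zero]
    assms[THEN boolean_algebra_on.meet_compl] assms[THEN boolean_algebra_on.join_compl]
  show ?thesis
  proof
    fix p q r
    assume "p \<in> carrier (product_balg J L)" "q \<in> carrier (product_balg J L)"
    then have pq: "p i \<in> carrier (L i)" "q i \<in> carrier (L i)" if "i \<in> J" for i
      using that by (auto simp: product_balg_def)
    then show "bmeet (product_balg J L) p q = bmeet (product_balg J L) q p"
      and "bjoin (product_balg J L) p q = bjoin (product_balg J L) q p"
      by (auto simp: product_balg_def intro!: restrict_ext
          assms[THEN boolean_algebra_on.meet_comm] assms[THEN boolean_algebra_on.join_comm])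
    assume "r \<in> carrier (product_balg J L)"
    then have "r i \<in> carrier (L i)" if "i \<in> J" for i
      using that by (auto simp: product_balg_def)
    with pq show "bmeet (product_balg J L) p (bjoin (product_balg J L) q r) =
        bjoin (product_balg J L) (bmeet (product_balg J L) p q) (bmeet (product_balg J L) p r)"
      and "bjoin (product_balg J L) p (bmeet (product_balg J L) q r) =
        bmeet (product_balg J L) (bjoin (product_balg J L) p q) (bjoin (product_balg J L) p r)"
      by (auto simp: product_balg_def intro!: restrict_ext
          assms[THEN boolean_algebra_on.meet_join_distrib]
          assms[THEN boolean_algebra_on.join_meet_distrib])
  qed (auto simp: product_balg_def * ** PiE_iff extensional_def fun_eq_iff)
qed

lemma product_ble_iff:
  assumes "p \<in> carrier (product_balg J L)"
  shows "ble (product_balg J L) p q \<longleftrightarrow> (\<forall>i\<in>J. ble (L i) (p i) (q i))"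
  using assms by (auto simp: product_balg_def ble_def fun_eq_iff PiE_iff extensional_def)

section \<open>Changing the data at the empty set\<close>

lemma fib_with_fib0 [simp]:
  "fib (with_fib0 A F) = fib A" "fib0 (with_fib0 A F) = F"
  "vr (with_fib0 A F) = vr A" "allq (with_fib0 A F) = allq A"
  by (simp_all add: with_fib0_def)

text \<open>Every axiom of \<open>substitution_target\<close> that speaks of a set of variables
  forces it to be nonempty, and reads only the part of \<open>A\<close> that
  \<open>with_fib0\<close> keeps. So neither adding the empty set to \<open>S\<close> nor replacing
  \<open>fib0\<close> affects it.\<close>

lemma substitution_target_with_fib0:
  "substitution_target S A F \<Longrightarrow> substitution_target (insert {} S) (with_fib0 A G) F"
  by (simp add: substitution_target_def)

lemma equality_target_with_fib0:
  "equality_target S A F \<Longrightarrow> equality_target (insert {} S) (with_fib0 A G) F"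
  by (simp add: equality_target_def)

context substitution_target
begin

lemma psub_closed:
  "X \<in> S \<Longrightarrow> X \<noteq> {} \<Longrightarrow> p \<in> carrier (Pr A X) \<Longrightarrow> \<sigma> \<in> X \<rightarrow>\<^sub>E terms F \<Longrightarrow>
    psub F X p \<sigma> \<in> carrier (props F)"
  using P4[of X \<sigma>] by (auto simp: boolean_hom_def)

lemma scomp_closed:
  "Y \<in> S \<Longrightarrow> Y \<noteq> {} \<Longrightarrow> \<rho> \<in> X \<rightarrow>\<^sub>E Tm A Y \<Longrightarrow> \<tau> \<in> Y \<rightarrow>\<^sub>E terms F \<Longrightarrow>
    scomp F X Y \<rho> \<tau> \<in> X \<rightarrow>\<^sub>E terms F"
  unfolding scomp_def by (intro restrict_PiE_iff[THEN iffD2] ballI tsub_closed) auto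

end

section \<open>Supports in arbitrary fibres, and nontriviality\<close>

context quantifier_theory
begin

lemma var_closed: "X \<in> S \<Longrightarrow> x \<in> X \<Longrightarrow> vr A X x \<in> Tm A X"
  using vr_closed by fastforce

text \<open>The retraction of the variables onto \<open>U\<close> fixes every element supported by \<open>U\<close>, and
  substitutions into any fibre factor through it. This needs \<open>U\<close> to be nonempty.\<close>

lemma supports_any_target:
  assumes F: "substitution_target S A F"
    and X: "X \<in> S" and U: "U \<subseteq> X" "U \<noteq> {}"
  shows "a \<in> Tm A X \<Longrightarrow> supports_term_in (fib A X) X U a \<Longrightarrow> supports_term_in F X U a"
    and "p \<in> carrier (Pr A X) \<Longrightarrow> supports_prop_in (fib A X) X U p \<Longrightarrow> supports_prop_in F X U p"
proof -
  interpret F: substitution_target S A F by fact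
  have ne: "X \<noteq> {}" using U by auto
  obtain u where u: "u \<in> U" "u \<in> X" using U by auto
  define r where "r = (\<lambda>x\<in>X. vr A X (if x \<in> U then x else u))"
  have r: "r \<in> X \<rightarrow>\<^sub>E Tm A X"
    using u X by (auto simp: r_def var_closed)
  have ru: "\<forall>x\<in>U. vr A X x = r x"
    using U by (auto simp: r_def)
  have comp: "scomp F X X r \<sigma> = (\<lambda>x\<in>X. \<sigma> (if x \<in> U then x else u))"
    if "\<sigma> \<in> X \<rightarrow>\<^sub>E terms F" for \<sigma>
    using that X u by (auto simp: scomp_def r_def F.P3 fun_eq_iff)
  have eq: "scomp F X X r \<sigma> = scomp F X X r \<tau>"
    if "\<sigma> \<in> X \<rightarrow>\<^sub>E terms F" "\<tau> \<in> X \<rightarrow>\<^sub>E terms F" "\<forall>x\<in>U. \<sigma> x = \<tau> x" for \<sigma> \<tau>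
    using that u by (auto simp: comp fun_eq_iff)
  show "supports_term_in F X U a" if a: "a \<in> Tm A X" "supports_term_in (fib A X) X U a"
  proof -
    have "tsub (fib A X) X a (vr A X) = tsub (fib A X) X a r"
      using a(2) ru r vr_closed[OF X ne] unfolding supports_term_in_def by blast
    then have "tsub F X a \<sigma> = tsub F X a (scomp F X X r \<sigma>)" if "\<sigma> \<in> X \<rightarrow>\<^sub>E terms F" for \<sigma>
      using F.P2_terms[OF X ne X ne a(1) r that] P1_terms[OF X ne a(1)] by simp
    then show ?thesis
      unfolding supports_term_in_def using eq by metis
  qed
  show "supports_prop_in F X U p" if p: "p \<in> carrier (Pr A X)" "supports_prop_in (fib A X) X U p"
  proof -
    have "psub (fib A X) X p (vr A X) = psub (fib A X) X p r"
      using p(2) ru r vr_closed[OF X ne] unfolding supports_prop_in_def by blast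
    then have "psub F X p \<sigma> = psub F X p (scomp F X X r \<sigma>)" if "\<sigma> \<in> X \<rightarrow>\<^sub>E terms F" for \<sigma>
      using F.P2_props[OF X ne X ne p(1) r that] P1_props[OF X ne p(1)] by simp
    then show ?thesis
      unfolding supports_prop_in_def using eq by metis
  qed
qed

text \<open>A given support may be empty, so some variable \<open>u\<close> is added first.
  Enlarging a support keeps it a support, and the result is finite, nonempty and valid in fibres
  that do not belong to \<open>A\<close>.\<close>

lemma finite_support_any_target_term:
  assumes lf: "locally_finite S A" and X: "X \<in> S" "X \<noteq> {}" and a: "a \<in> Tm A X"
  obtains U where "finite U" "U \<subseteq> X"
    "\<And>F :: ('v, 'a, 'p, 'c, 'r) fibre. substitution_target S A F \<Longrightarrow> supports_term_in F X U a"
proof -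
  obtain U where U: "finite U" "term_support S A X U a"
    using lf X a unfolding locally_finite_def by blast
  obtain u where u: "u \<in> X"
    using X by auto
  have "supports_term_in (fib A X) X U a" and sub: "insert u U \<subseteq> X"
    using U(2) X u by (simp_all add: term_support_def)
  then have supp: "supports_term_in (fib A X) X (insert u U) a"
    unfolding supports_term_in_def by blast
  show ?thesis
    by (rule that[of "insert u U"]) (simp_all add: U(1) sub[simplified] X(1) a supp
        supports_any_target(1)[OF _ X(1) sub _ a])
qed

lemma finite_support_any_target_prop:
  assumes lf: "locally_finite S A" and X: "X \<in> S" "X \<noteq> {}" and p: "p \<in> carrier (Pr A X)"
  obtains U where "finite U" "U \<subseteq> X"
    "\<And>F :: ('v, 'a, 'p, 'c, 'r) fibre. substitution_target S A F \<Longrightarrow> supports_prop_in F X U p"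
proof -
  obtain U where U: "finite U" "prop_support S A X U p"
    using lf X p unfolding locally_finite_def by blast
  obtain u where u: "u \<in> X"
    using X by auto
  have "supports_prop_in (fib A X) X U p" and sub: "insert u U \<subseteq> X"
    using U(2) X u by (simp_all add: prop_support_def)
  then have supp: "supports_prop_in (fib A X) X (insert u U) p"
    unfolding supports_prop_in_def by blast
  show ?thesis
    by (rule that[of "insert u U"]) (simp_all add: U(1) sub[simplified] X(1) p supp
        supports_any_target(2)[OF _ X(1) sub _ p])
qed

text \<open>Nontriviality may be witnessed at the empty set only, and the data there are about to be
  replaced. Renaming the variables into a set with two elements moves the witness.\<close>

lemma nontrivial_nonempty:
  obtains X p Y where "X \<in> S" "X \<noteq> {}" "p \<in> carrier (Pr A X)" "Y \<in> S" "Y \<noteq> {}"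
    "\<not> supports_prop_in (fib A Y) X {} p"
proof (rule ccontr)
  assume "\<not> thesis"
  with that have closed: "psub (fib A Y) X p \<sigma> = psub (fib A Y) X p \<tau>"
    if "X \<in> S" "X \<noteq> {}" "p \<in> carrier (Pr A X)" "Y \<in> S" "Y \<noteq> {}"
      "\<sigma> \<in> X \<rightarrow>\<^sub>E Tm A Y" "\<tau> \<in> X \<rightarrow>\<^sub>E Tm A Y" for X p Y \<sigma> \<tau>
    using that unfolding supports_prop_in_def by blast
  obtain X p where X: "X \<in> S" "X \<noteq> {}" and p: "p \<in> carrier (Pr A X)"
    and nt: "\<not> prop_support S A X {} p"
    using nontrivial by blast
  have "supports_prop_in (fib A Y) X {} p" if "Y \<in> S" "Y \<noteq> {}" for Y
    unfolding supports_prop_in_def using closed[OF X p that] by blast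
  then have e: "{} \<in> S" and "\<not> supports_prop_in (fib0 A) X {} p"
    using nt unfolding prop_support_def by blast+
  then obtain \<sigma> \<tau> where \<sigma>: "\<sigma> \<in> X \<rightarrow>\<^sub>E terms (fib0 A)" and \<tau>: "\<tau> \<in> X \<rightarrow>\<^sub>E terms (fib0 A)"
    and ne: "psub (fib0 A) X p \<sigma> \<noteq> psub (fib0 A) X p \<tau>"
    unfolding supports_prop_in_def by blast
  interpret T: substitution_target S A "fib0 A"
    using e by (rule target0)
  obtain x where x: "x \<in> X" using X by auto
  obtain Z where Z: "Z \<in> S" "infinite Z" using infinite_vars by blast
  obtain z z' where z: "z \<in> Z" "z' \<in> Z" "z \<noteq> z'"
    using infinite_arbitrarily_large[OF Z(2), of 2] by (auto simp: card_2_iff)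
  then have Zne: "Z \<noteq> {}" by auto
  \<comment> \<open>The negated claim makes \<open>p\<close> insensitive to substitutions into
    nonempty fibres, so the identity may be traded for the constant map at \<open>x\<close>. Over
    the empty set \<open>p\<close> then sees a map only through its value at
    \<open>x\<close>.\<close>
  have const: "psub (fib0 A) X p \<rho> = psub (fib0 A) X p (\<lambda>_\<in>X. \<rho> x)"
    if \<rho>: "\<rho> \<in> X \<rightarrow>\<^sub>E terms (fib0 A)" for \<rho>
  proof -
    have "psub (fib0 A) X p \<rho> = psub (fib0 A) X (psub (fib A X) X p (vr A X)) \<rho>"
      by (simp add: P1_props X p)
    also have "\<dots> = psub (fib0 A) X (psub (fib A X) X p (\<lambda>_\<in>X. vr A X x)) \<rho>"
      using X p x vr_closed var_closed by (intro arg_cong2[where f = "psub (fib0 A) X"] closed) auto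
    also have "\<dots> = psub (fib0 A) X p (scomp (fib0 A) X X (\<lambda>_\<in>X. vr A X x) \<rho>)"
      using X p x \<rho> var_closed by (intro T.P2_props) auto
    also have "scomp (fib0 A) X X (\<lambda>_\<in>X. vr A X x) \<rho> = (\<lambda>_\<in>X. \<rho> x)"
      using X x \<rho> by (auto simp: scomp_def T.P3)
    finally show ?thesis .
  qed
  \<comment> \<open>\<open>\<rho>\<close> sends two variables of \<open>Z\<close> to the two values
    to be told apart. The renamings of \<open>p\<close> to \<open>z\<close> and to \<open>z'\<close>
    agree over \<open>Z\<close>, yet \<open>\<rho>\<close> evaluates them to the two sides of
    \<open>ne\<close>, by \<open>const\<close>.\<close>
  define \<rho> where "\<rho> = (\<lambda>y\<in>Z. if y = z then \<sigma> x else \<tau> x)"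
  have \<rho>: "\<rho> \<in> Z \<rightarrow>\<^sub>E terms (fib0 A)"
    using \<sigma> \<tau> x by (auto simp: \<rho>_def)
  have at: "psub (fib0 A) Z (psub (fib A Z) X p (\<lambda>_\<in>X. vr A Z y)) \<rho> = psub (fib0 A) X p (\<lambda>_\<in>X. \<rho> y)"
    if y: "y \<in> Z" for y
  proof -
    have "scomp (fib0 A) X Z (\<lambda>_\<in>X. vr A Z y) \<rho> = (\<lambda>_\<in>X. \<rho> y)"
      using Z y \<rho> by (auto simp: scomp_def T.P3)
    moreover have "(\<lambda>_\<in>X. vr A Z y) \<in> X \<rightarrow>\<^sub>E Tm A Z"
      using Z y var_closed by auto
    ultimately show ?thesis
      using T.P2_props[OF X Z(1) Zne p _ \<rho>] by metis
  qed
  have "psub (fib A Z) X p (\<lambda>_\<in>X. vr A Z z) = psub (fib A Z) X p (\<lambda>_\<in>X. vr A Z z')"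
    using X p Z Zne z var_closed by (intro closed) auto
  then have "psub (fib0 A) X p (\<lambda>_\<in>X. \<rho> z) = psub (fib0 A) X p (\<lambda>_\<in>X. \<rho> z')"
    using at z by metis
  then have "psub (fib0 A) X p (\<lambda>_\<in>X. \<sigma> x) = psub (fib0 A) X p (\<lambda>_\<in>X. \<tau> x)"
    using z by (simp add: \<rho>_def)
  with ne show False
    using const \<sigma> \<tau> by simp
qed

end

context quantifier_theory_with_equality
begin

text \<open>The quantifier axioms and (E3) involve a variable of the set in question, so they are
  vacuous at the empty set and inherited elsewhere. Only substitution and equality at the empty set
  remain, which are the two hypotheses. Nontriviality survives because it has a witness among the
  nonempty fibres.\<close>

lemma modification_with_fib0:
  assumes F: "substitution_target S A F" and eqF: "equality_target S A F"
  shows "modification S A (with_fib0 A F)"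
proof -
  have "quantifier_theory (insert {} S) (with_fib0 A F)"
  proof (rule quantifier_theory.intro)
    obtain X p Y where "X \<in> S" "X \<noteq> {}" "p \<in> carrier (Pr A X)" "Y \<in> S" "Y \<noteq> {}"
      "\<not> supports_prop_in (fib A Y) X {} p"
      by (rule nontrivial_nonempty)
    then show "\<exists>X\<in>insert {} S. X \<noteq> {} \<and> (\<exists>p\<in>carrier (Pr (with_fib0 A F) X).
        \<not> prop_support (insert {} S) (with_fib0 A F) X {} p)"
      by (auto simp: prop_support_def)
  next
    show "\<exists>X\<in>insert {} S. infinite X"
      using infinite_vars by auto
  next
    fix X x p Y \<sigma> y z
    assume "X \<in> insert {} S" "x \<in> X" "p \<in> carrier (Pr (with_fib0 A F) X)" "Y \<in> insert {} S"
      "\<sigma> \<in> X \<rightarrow>\<^sub>E Tm (with_fib0 A F) Y" "y \<in> Y" "z \<in> Y" "y \<noteq> z"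
      "scomp (fib (with_fib0 A F) Y) X Y \<sigma>
        (subst_one (with_fib0 A F) Y (vr (with_fib0 A F) Y z) y) = \<sigma>"
    then show "psub (fib (with_fib0 A F) Y) X (allq (with_fib0 A F) X x p) \<sigma> =
        allq (with_fib0 A F) Y y
          (psub (fib (with_fib0 A F) Y) X p (\<sigma>(x := vr (with_fib0 A F) Y y)))"
      using P5[of X x p Y \<sigma> y z] by (auto simp: subst_one_def)
  next
    fix X x p y
    assume "X \<in> insert {} S" "x \<in> X" "p \<in> carrier (Pr (with_fib0 A F) X)" "y \<in> X" "y \<noteq> x"
      "psub (fib (with_fib0 A F) X) X p
        (subst_one (with_fib0 A F) X (vr (with_fib0 A F) X y) x) = p"
    then show "allq (with_fib0 A F) X x p = p"
      using Q3[of X x p y] by (auto simp: subst_one_def)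
  qed (use F in \<open>auto simp: vr_closed allq_closed P1_terms P1_props Q1 Q2
      intro!: substitution_target_with_fib0 target\<close>)
  moreover have "quantifier_theory_with_equality_axioms (insert {} S) (with_fib0 A F)"
  proof (rule quantifier_theory_with_equality_axioms.intro)
    fix X x y p
    assume "X \<in> insert {} S" "x \<in> X" "y \<in> X" "p \<in> carrier (Pr (with_fib0 A F) X)"
    then show "ble (Pr (with_fib0 A F) X)
        (bmeet (Pr (with_fib0 A F) X) p
          (eql (fib (with_fib0 A F) X) (vr (with_fib0 A F) X x) (vr (with_fib0 A F) X y)))
        (psub (fib (with_fib0 A F) X) X p
          (subst_one (with_fib0 A F) X (vr (with_fib0 A F) X x) y))"
      using E3[of X x y p] by (auto simp: subst_one_def)
  qed (use eqF in \<open>auto intro!: equality_target_with_fib0 eq_target\<close>)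
  ultimately show ?thesis
    by (simp add: modification_def quantifier_theory_with_equality_def same_restriction_def
        same_balg_def)
qed

end

text \<open>In the opposite direction, the fibre of a modification at the empty set satisfies the
  axioms relative to \<open>A\<close> itself. This makes the factors comparable: all become fibres
  over one and the same theory.\<close>

lemma modification_target:
  assumes "modification S A B"
  shows "substitution_target S A (fib0 B)" and "equality_target S A (fib0 B)"
proof -
  interpret B: quantifier_theory_with_equality "insert {} S" B
    using assms by (simp add: modification_def)
  interpret T: substitution_target "insert {} S" B "fib0 B"
    by (rule B.target0) simp
  interpret E: equality_target "insert {} S" B "fib0 B"
    by (rule B.eq_target0) simp
  have Tm: "Tm B X = Tm A X" and Pr: "same_balg (Pr B X) (Pr A X)"
    and vr: "\<And>x. x \<in> X \<Longrightarrow> vr B X x = vr A X x"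
    and eql: "\<And>a b. a \<in> Tm A X \<Longrightarrow> b \<in> Tm A X \<Longrightarrow> eql (fib B X) a b = eql (fib A X) a b"
    if "X \<in> S" "X \<noteq> {}" for X
    using that assms by (auto simp: modification_def same_restriction_def)
  have sub: "a \<in> Tm A X \<Longrightarrow> tsub (fib B Y) X a \<sigma> = tsub (fib A Y) X a \<sigma>"
    "p \<in> carrier (Pr A X) \<Longrightarrow> psub (fib B Y) X p \<sigma> = psub (fib A Y) X p \<sigma>"
    if "X \<in> S" "X \<noteq> {}" "Y \<in> S" "Y \<noteq> {}" "\<sigma> \<in> X \<rightarrow>\<^sub>E Tm A Y" for X Y \<sigma> a p
    using that assms by (auto simp: modification_def same_restriction_def)
  have carr: "carrier (Pr B X) = carrier (Pr A X)" if "X \<in> S" "X \<noteq> {}" for X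
    using Pr[OF that] by (simp add: same_balg_def)
  show "substitution_target S A (fib0 B)"
  proof (rule substitution_target.intro)
    fix X a \<sigma>
    assume "X \<in> S" "X \<noteq> {}" "a \<in> Tm A X" "\<sigma> \<in> X \<rightarrow>\<^sub>E terms (fib0 B)"
    then show "tsub (fib0 B) X a \<sigma> \<in> terms (fib0 B)"
      by (intro T.tsub_closed) (auto simp: Tm)
  next
    fix X Y a \<rho> \<tau>
    assume "X \<in> S" "X \<noteq> {}" "Y \<in> S" "Y \<noteq> {}" "a \<in> Tm A X" "\<rho> \<in> X \<rightarrow>\<^sub>E Tm A Y"
      "\<tau> \<in> Y \<rightarrow>\<^sub>E terms (fib0 B)"
    then show "tsub (fib0 B) Y (tsub (fib A Y) X a \<rho>) \<tau> =
        tsub (fib0 B) X a (scomp (fib0 B) X Y \<rho> \<tau>)"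
      using T.P2_terms[of X Y a \<rho> \<tau>] by (simp add: Tm sub)
  next
    fix X Y p \<rho> \<tau>
    assume "X \<in> S" "X \<noteq> {}" "Y \<in> S" "Y \<noteq> {}" "p \<in> carrier (Pr A X)" "\<rho> \<in> X \<rightarrow>\<^sub>E Tm A Y"
      "\<tau> \<in> Y \<rightarrow>\<^sub>E terms (fib0 B)"
    then show "psub (fib0 B) Y (psub (fib A Y) X p \<rho>) \<tau> =
        psub (fib0 B) X p (scomp (fib0 B) X Y \<rho> \<tau>)"
      using T.P2_props[of X Y p \<rho> \<tau>] by (simp add: Tm carr sub)
  next
    fix X x \<sigma>
    assume "X \<in> S" "x \<in> X" "\<sigma> \<in> X \<rightarrow>\<^sub>E terms (fib0 B)"
    moreover from this have "X \<noteq> {}"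
      by auto
    ultimately show "tsub (fib0 B) X (vr A X x) \<sigma> = \<sigma> x"
      using T.P3[of X x \<sigma>] by (simp add: vr)
  next
    fix X \<sigma>
    assume X: "X \<in> S" "X \<noteq> {}" and "\<sigma> \<in> X \<rightarrow>\<^sub>E terms (fib0 B)"
    then have "boolean_hom (Pr B X) (props (fib0 B)) (\<lambda>p. psub (fib0 B) X p \<sigma>)"
      by (intro T.P4) auto
    moreover have "boolean_algebra_on (Pr B X)"
      using X by (intro substitution_target.props_boolean[OF B.target]) auto
    ultimately show "boolean_hom (Pr A X) (props (fib0 B)) (\<lambda>p. psub (fib0 B) X p \<sigma>)"
      using Pr[OF X] by (rule boolean_hom_same_domain)
  qed (rule T.props_boolean)
  show "equality_target S A (fib0 B)"
  proof (rule equality_target.intro)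
    fix X a b \<sigma>
    assume "X \<in> S" "X \<noteq> {}" "a \<in> Tm A X" "b \<in> Tm A X" "\<sigma> \<in> X \<rightarrow>\<^sub>E terms (fib0 B)"
    then show "psub (fib0 B) X (eql (fib A X) a b) \<sigma> =
        eql (fib0 B) (tsub (fib0 B) X a \<sigma>) (tsub (fib0 B) X b \<sigma>)"
      using E.E1[of X a b \<sigma>] by (simp add: Tm eql)
  qed (simp_all add: E.eql_closed E.E2)
qed

section \<open>Products\<close>

lemma product_component:
  assumes "\<sigma> \<in> X \<rightarrow>\<^sub>E terms (fib0 (product_modification A J Bi))" "i \<in> J"
  shows "(\<lambda>x\<in>X. \<sigma> x i) \<in> X \<rightarrow>\<^sub>E terms (fib0 (Bi i))"
  using assms by (fastforce simp: product_modification_def)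

text \<open>The axioms hold in each coordinate. For (P2) this requires that passing to coordinate
  \<open>i\<close> commute with composition of substitutions.\<close>

lemma product_substitution_target:
  assumes Bi: "\<And>i. i \<in> J \<Longrightarrow> substitution_target S A (fib0 (Bi i))"
  shows "substitution_target S A (fib0 (product_modification A J Bi))"
    (is "substitution_target S A ?F")
proof (rule substitution_target.intro)
  show "boolean_algebra_on (props ?F)"
    using Bi[THEN substitution_target.props_boolean]
    by (simp add: product_modification_def product_boolean_algebra)
next
  fix X a \<sigma>
  assume "X \<in> S" "X \<noteq> {}" "a \<in> Tm A X" "\<sigma> \<in> X \<rightarrow>\<^sub>E terms ?F"
  then have "tsub (fib0 (Bi i)) X a (\<lambda>x\<in>X. \<sigma> x i) \<in> terms (fib0 (Bi i))" if "i \<in> J" for i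
    using that by (intro substitution_target.tsub_closed[OF Bi] product_component)
  then show "tsub ?F X a \<sigma> \<in> terms ?F"
    by (simp add: product_modification_def)
next
  fix X Y a \<rho> \<tau>
  assume *: "X \<in> S" "X \<noteq> {}" "Y \<in> S" "Y \<noteq> {}" "a \<in> Tm A X" "\<rho> \<in> X \<rightarrow>\<^sub>E Tm A Y"
    and \<tau>: "\<tau> \<in> Y \<rightarrow>\<^sub>E terms ?F"
  have "tsub (fib0 (Bi i)) Y (tsub (fib A Y) X a \<rho>) (\<lambda>y\<in>Y. \<tau> y i) =
      tsub (fib0 (Bi i)) X a (\<lambda>x\<in>X. scomp ?F X Y \<rho> \<tau> x i)" if i: "i \<in> J" for i
  proof -
    have "(\<lambda>x\<in>X. scomp ?F X Y \<rho> \<tau> x i) = scomp (fib0 (Bi i)) X Y \<rho> (\<lambda>y\<in>Y. \<tau> y i)"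
      using i by (auto simp: scomp_def product_modification_def)
    then show ?thesis
      using substitution_target.P2_terms[OF Bi[OF i] * product_component[OF \<tau> i]] by simp
  qed
  then show "tsub ?F Y (tsub (fib A Y) X a \<rho>) \<tau> = tsub ?F X a (scomp ?F X Y \<rho> \<tau>)"
    by (auto simp: product_modification_def intro!: restrict_ext)
next
  fix X Y p \<rho> \<tau>
  assume *: "X \<in> S" "X \<noteq> {}" "Y \<in> S" "Y \<noteq> {}" "p \<in> carrier (Pr A X)" "\<rho> \<in> X \<rightarrow>\<^sub>E Tm A Y"
    and \<tau>: "\<tau> \<in> Y \<rightarrow>\<^sub>E terms ?F"
  have "psub (fib0 (Bi i)) Y (psub (fib A Y) X p \<rho>) (\<lambda>y\<in>Y. \<tau> y i) =
      psub (fib0 (Bi i)) X p (\<lambda>x\<in>X. scomp ?F X Y \<rho> \<tau> x i)" if i: "i \<in> J" for i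
  proof -
    have "(\<lambda>x\<in>X. scomp ?F X Y \<rho> \<tau> x i) = scomp (fib0 (Bi i)) X Y \<rho> (\<lambda>y\<in>Y. \<tau> y i)"
      using i by (auto simp: scomp_def product_modification_def)
    then show ?thesis
      using substitution_target.P2_props[OF Bi[OF i] * product_component[OF \<tau> i]] by simp
  qed
  then show "psub ?F Y (psub (fib A Y) X p \<rho>) \<tau> = psub ?F X p (scomp ?F X Y \<rho> \<tau>)"
    by (auto simp: product_modification_def intro!: restrict_ext)
next
  fix X x \<sigma>
  assume *: "X \<in> S" "x \<in> X" and \<sigma>: "\<sigma> \<in> X \<rightarrow>\<^sub>E terms ?F"
  have "tsub (fib0 (Bi i)) X (vr A X x) (\<lambda>x\<in>X. \<sigma> x i) = \<sigma> x i" if "i \<in> J" for i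
    using substitution_target.P3[OF Bi[OF that] * product_component[OF \<sigma> that]] *(2) by simp
  \<comment> \<open>Agreement in all coordinates determines an element of the product only on
    \<open>J\<close>; outside \<open>J\<close>, extensionality settles the equality of
    functions.\<close>
  moreover have "\<sigma> x \<in> extensional J"
    using PiE_mem[OF \<sigma> *(2)] by (simp add: product_modification_def PiE_iff)
  ultimately show "tsub ?F X (vr A X x) \<sigma> = \<sigma> x"
    by (auto simp: product_modification_def extensional_def)
next
  fix X \<sigma>
  assume *: "X \<in> S" "X \<noteq> {}" and \<sigma>: "\<sigma> \<in> X \<rightarrow>\<^sub>E terms ?F"
  have "boolean_hom (Pr A X) (props (fib0 (Bi i))) (\<lambda>p. psub (fib0 (Bi i)) X p (\<lambda>x\<in>X. \<sigma> x i))"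
    if "i \<in> J" for i
    using that by (intro substitution_target.P4[OF Bi] * product_component[OF \<sigma>])
  then show "boolean_hom (Pr A X) (props ?F) (\<lambda>p. psub ?F X p \<sigma>)"
    by (auto simp: boolean_hom_def product_modification_def product_balg_def Pi_iff
        intro!: restrict_ext)
qed

lemma product_equality_target:
  assumes Bi: "\<And>i. i \<in> J \<Longrightarrow> equality_target S A (fib0 (Bi i))"
  shows "equality_target S A (fib0 (product_modification A J Bi))"
    (is "equality_target S A ?F")
proof (rule equality_target.intro)
  fix c d
  assume "c \<in> terms ?F" "d \<in> terms ?F"
  then show "eql ?F c d \<in> carrier (props ?F)"
    by (auto simp: product_modification_def product_balg_def
        intro!: equality_target.eql_closed[OF Bi])
next
  fix X a b \<sigma>
  assume "X \<in> S" "X \<noteq> {}" "a \<in> Tm A X" "b \<in> Tm A X" "\<sigma> \<in> X \<rightarrow>\<^sub>E terms ?F"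
  then have "psub (fib0 (Bi i)) X (eql (fib A X) a b) (\<lambda>x\<in>X. \<sigma> x i) =
      eql (fib0 (Bi i)) (tsub (fib0 (Bi i)) X a (\<lambda>x\<in>X. \<sigma> x i))
        (tsub (fib0 (Bi i)) X b (\<lambda>x\<in>X. \<sigma> x i))" if "i \<in> J" for i
    using that by (intro equality_target.E1[OF Bi] product_component)
  then show "psub ?F X (eql (fib A X) a b) \<sigma> = eql ?F (tsub ?F X a \<sigma>) (tsub ?F X b \<sigma>)"
    by (auto simp: product_modification_def intro!: restrict_ext)
next
  fix c
  assume "c \<in> terms ?F"
  then show "eql ?F c c = bone (props ?F)"
    by (auto simp: product_modification_def product_balg_def
        intro!: restrict_ext equality_target.E2[OF Bi])
qed

section \<open>Quotients\<close>

text \<open>Terms are untouched, and substitution into propositions is followed by the class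
  homomorphism, which preserves (P2) and (P4).\<close>

lemma filter_quotient_substitution_target:
  assumes "substitution_target S A (fib0 B)" and "is_ultrafilter_of (props (fib0 B)) I"
  shows "substitution_target S A (fib0 (filter_quotient B I))"
proof -
  interpret T: substitution_target S A "fib0 B" by fact
  interpret U: ultrafilter_on "props (fib0 B)" I
    using assms(2) T.props_boolean by (simp add: ultrafilter_on_def ultrafilter_on_axioms_def)
  have sc: "scomp (fib0 (filter_quotient B I)) = scomp (fib0 B)"
    by (simp add: scomp_def filter_quotient_def fun_eq_iff)
  show ?thesis
    by (rule substitution_target.intro, unfold sc)
      (simp_all add: filter_quotient_def U.quotient_boolean_algebra T.tsub_closed
        T.P2_terms T.P2_props T.P3 boolean_hom_comp[OF T.P4 U.filter_class_hom])
qed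

lemma filter_quotient_equality_target:
  assumes "substitution_target S A (fib0 B)" and "equality_target S A (fib0 B)"
    and "is_ultrafilter_of (props (fib0 B)) I"
  shows "equality_target S A (fib0 (filter_quotient B I))"
proof -
  interpret T: substitution_target S A "fib0 B" by fact
  interpret E: equality_target S A "fib0 B" by fact
  interpret U: ultrafilter_on "props (fib0 B)" I
    using assms(3) T.props_boolean by (simp add: ultrafilter_on_def ultrafilter_on_axioms_def)
  show ?thesis
    by (rule equality_target.intro)
      (simp_all add: filter_quotient_def U.filter_class_closed E.eql_closed E.E1 E.E2
        U.filter_class_eq_one_iff U.one_closed U.one_mem)
qed

section \<open>The quotient by a congruent equality\<close>

lemma THE_constant:
  assumes "x \<in> D" "\<And>y. y \<in> D \<Longrightarrow> f y = c"
  shows "(THE c. \<forall>y\<in>D. f y = c) = c"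
proof (rule the_equality)
  fix c' assume "\<forall>y\<in>D. f y = c'"
  then have "f x = c'" using assms(1) by (rule bspec)
  then show "c' = c" using assms(2)[OF assms(1)] by simp
qed (simp add: assms(2))

text \<open>The congruence conditions are what makes the descriptions in
  \<open>equality_quotient\<close> denote. Isolating them separates the passage to \<theta>-classes
  from the reason why \<theta> is a congruence in an ultraproduct.\<close>

locale congruent_equality =
  quantifier_theory_with_equality S A + substitution_target S A "fib0 C" +
  equality_target S A "fib0 C"
  for S :: "'v set set"
    and A :: "('v, 'a, 'p, 'b, 'q) qtheory"
    and C :: "('v, 'a, 'p, 'd, 'r) qtheory" +
  assumes equiv: "equiv (terms (fib0 C)) (eq_rel C)"
    and tsub_cong: "X \<in> S \<Longrightarrow> X \<noteq> {} \<Longrightarrow> a \<in> Tm A X \<Longrightarrow> \<sigma> \<in> X \<rightarrow>\<^sub>E terms (fib0 C) \<Longrightarrow>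
      \<tau> \<in> X \<rightarrow>\<^sub>E terms (fib0 C) \<Longrightarrow> (\<And>x. x \<in> X \<Longrightarrow> (\<sigma> x, \<tau> x) \<in> eq_rel C) \<Longrightarrow>
      (tsub (fib0 C) X a \<sigma>, tsub (fib0 C) X a \<tau>) \<in> eq_rel C"
    and psub_cong: "X \<in> S \<Longrightarrow> X \<noteq> {} \<Longrightarrow> p \<in> carrier (Pr A X) \<Longrightarrow> \<sigma> \<in> X \<rightarrow>\<^sub>E terms (fib0 C) \<Longrightarrow>
      \<tau> \<in> X \<rightarrow>\<^sub>E terms (fib0 C) \<Longrightarrow> (\<And>x. x \<in> X \<Longrightarrow> (\<sigma> x, \<tau> x) \<in> eq_rel C) \<Longrightarrow>
      psub (fib0 C) X p \<sigma> = psub (fib0 C) X p \<tau>"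
    and eql_cong: "(c, c') \<in> eq_rel C \<Longrightarrow> (d, d') \<in> eq_rel C \<Longrightarrow>
      eql (fib0 C) c d = eql (fib0 C) c' d'"
begin

abbreviation Q :: "('v, 'a, 'p, 'd set, 'r) fibre" where
  "Q \<equiv> fib0 (equality_quotient C)"

text \<open>Every map into the classes has this form for some lift, so statements about
  \<open>Q\<close> reduce to statements about maps into \<open>fib0 C\<close>.\<close>

definition class_map :: "'v set \<Rightarrow> ('v \<Rightarrow> 'd) \<Rightarrow> 'v \<Rightarrow> 'd set" where
  "class_map X \<sigma> = (\<lambda>x\<in>X. eq_rel C `` {\<sigma> x})"

lemma Q_terms [simp]: "terms Q = terms (fib0 C) // eq_rel C"
  and Q_props [simp]: "props Q = props (fib0 C)"
  by (simp_all add: equality_quotient_def)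

lemma class_self: "c \<in> terms (fib0 C) \<Longrightarrow> c \<in> eq_rel C `` {c}"
  using equiv by (rule equiv_class_self)

lemma lift_iff:
  assumes "\<sigma> \<in> X \<rightarrow>\<^sub>E terms (fib0 C)"
  shows "\<tau> \<in> Pi\<^sub>E X (class_map X \<sigma>) \<longleftrightarrow>
    \<tau> \<in> X \<rightarrow>\<^sub>E terms (fib0 C) \<and> (\<forall>x\<in>X. (\<sigma> x, \<tau> x) \<in> eq_rel C)"
  using assms equiv by (auto simp: class_map_def PiE_iff eq_rel_def)

lemma lift_self: "\<sigma> \<in> X \<rightarrow>\<^sub>E terms (fib0 C) \<Longrightarrow> \<sigma> \<in> Pi\<^sub>E X (class_map X \<sigma>)"
  using equiv by (auto simp: lift_iff equiv_def refl_on_def)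

lemma class_mapE:
  assumes "s \<in> X \<rightarrow>\<^sub>E terms Q"
  obtains \<sigma> where "\<sigma> \<in> X \<rightarrow>\<^sub>E terms (fib0 C)" "s = class_map X \<sigma>"
proof -
  have "\<forall>x\<in>X. \<exists>c. c \<in> terms (fib0 C) \<and> s x = eq_rel C `` {c}"
    using assms by (auto elim!: quotientE dest!: PiE_mem)
  then obtain f where f: "\<forall>x\<in>X. f x \<in> terms (fib0 C) \<and> s x = eq_rel C `` {f x}"
    by metis
  show ?thesis
  proof
    show "restrict f X \<in> X \<rightarrow>\<^sub>E terms (fib0 C)"
      using f by auto
    show "s = class_map X (restrict f X)"
      using f assms by (auto simp: class_map_def fun_eq_iff PiE_iff extensional_def)
  qed
qed

text \<open>All lifts are pointwise \<theta>-related to \<open>\<sigma>\<close>, so by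
  \<open>tsub_cong\<close> they give one class; since \<open>\<sigma>\<close> is itself a lift, the
  description is determined.\<close>

lemma Q_tsub:
  assumes "X \<in> S" "X \<noteq> {}" "a \<in> Tm A X" "\<sigma> \<in> X \<rightarrow>\<^sub>E terms (fib0 C)"
  shows "tsub Q X a (class_map X \<sigma>) = eq_rel C `` {tsub (fib0 C) X a \<sigma>}"
proof -
  have "eq_rel C `` {tsub (fib0 C) X a \<tau>} = eq_rel C `` {tsub (fib0 C) X a \<sigma>}"
    if "\<tau> \<in> Pi\<^sub>E X (class_map X \<sigma>)" for \<tau>
    using that assms unfolding lift_iff[OF assms(4)]
    by (intro equiv_class_eq[OF equiv, symmetric] tsub_cong) auto
  from THE_constant[OF lift_self[OF assms(4)] this] show ?thesis
    by (simp add: equality_quotient_def)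
qed

lemma Q_psub:
  assumes "X \<in> S" "X \<noteq> {}" "p \<in> carrier (Pr A X)" "\<sigma> \<in> X \<rightarrow>\<^sub>E terms (fib0 C)"
  shows "psub Q X p (class_map X \<sigma>) = psub (fib0 C) X p \<sigma>"
proof -
  have "psub (fib0 C) X p \<tau> = psub (fib0 C) X p \<sigma>"
    if "\<tau> \<in> Pi\<^sub>E X (class_map X \<sigma>)" for \<tau>
    using that assms unfolding lift_iff[OF assms(4)]
    by (intro psub_cong[symmetric]) auto
  from THE_constant[OF lift_self[OF assms(4)] this] show ?thesis
    by (simp add: equality_quotient_def)
qed

lemma Q_eql:
  assumes "c \<in> terms (fib0 C)" "d \<in> terms (fib0 C)"
  shows "eql Q (eq_rel C `` {c}) (eq_rel C `` {d}) = eql (fib0 C) c d"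
proof -
  \<comment> \<open>Pairs turn the two nested quantifiers over representatives into one, the form
    that \<open>THE_constant\<close> handles.\<close>
  have "eql (fib0 C) (fst z) (snd z) = eql (fib0 C) c d"
    if "z \<in> eq_rel C `` {c} \<times> eq_rel C `` {d}" for z
    using that by (intro eql_cong[symmetric]) auto
  moreover have "(c, d) \<in> eq_rel C `` {c} \<times> eq_rel C `` {d}"
    using assms class_self by blast
  ultimately have "(THE q. \<forall>z\<in>eq_rel C `` {c} \<times> eq_rel C `` {d}.
      eql (fib0 C) (fst z) (snd z) = q) = eql (fib0 C) c d"
    by (rule THE_constant[rotated])
  then show ?thesis
    by (simp add: equality_quotient_def)
qed

text \<open>Composition is compatible with lifting, which brings (P2) down from \<open>C\<close> to
  the classes.\<close>

lemma Q_scomp: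
  assumes "Y \<in> S" "Y \<noteq> {}" "\<rho> \<in> X \<rightarrow>\<^sub>E Tm A Y" "\<tau> \<in> Y \<rightarrow>\<^sub>E terms (fib0 C)"
  shows "scomp Q X Y \<rho> (class_map Y \<tau>) = class_map X (scomp (fib0 C) X Y \<rho> \<tau>)"
proof -
  have "tsub Q Y (\<rho> x) (class_map Y \<tau>) = eq_rel C `` {tsub (fib0 C) Y (\<rho> x) \<tau>}" if "x \<in> X" for x
    using that assms by (intro Q_tsub) auto
  then show ?thesis
    unfolding scomp_def class_map_def[of X] by (intro restrict_ext) simp
qed

lemma equality_quotient_substitution_target: "substitution_target S A Q"
proof (rule substitution_target.intro)
  show "boolean_algebra_on (props Q)"
    using props_boolean by simp
next
  fix X a s
  assume "X \<in> S" "X \<noteq> {}" "a \<in> Tm A X" "s \<in> X \<rightarrow>\<^sub>E terms Q"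
  then show "tsub Q X a s \<in> terms Q"
    by (elim class_mapE) (simp add: Q_tsub tsub_closed quotientI)
next
  fix X Y a \<rho> s
  assume "X \<in> S" "X \<noteq> {}" "Y \<in> S" "Y \<noteq> {}" "a \<in> Tm A X" "\<rho> \<in> X \<rightarrow>\<^sub>E Tm A Y"
    "s \<in> Y \<rightarrow>\<^sub>E terms Q"
  moreover from this have "tsub (fib A Y) X a \<rho> \<in> Tm A Y"
    by (intro substitution_target.tsub_closed[OF target])
  ultimately show "tsub Q Y (tsub (fib A Y) X a \<rho>) s = tsub Q X a (scomp Q X Y \<rho> s)"
    by (elim class_mapE) (simp add: Q_tsub Q_scomp scomp_closed P2_terms)
next
  fix X Y p \<rho> s
  assume "X \<in> S" "X \<noteq> {}" "Y \<in> S" "Y \<noteq> {}" "p \<in> carrier (Pr A X)" "\<rho> \<in> X \<rightarrow>\<^sub>E Tm A Y"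
    "s \<in> Y \<rightarrow>\<^sub>E terms Q"
  moreover from this have "psub (fib A Y) X p \<rho> \<in> carrier (Pr A Y)"
    by (intro substitution_target.psub_closed[OF target])
  ultimately show "psub Q Y (psub (fib A Y) X p \<rho>) s = psub Q X p (scomp Q X Y \<rho> s)"
    by (elim class_mapE) (simp add: Q_psub Q_scomp scomp_closed P2_props)
next
  fix X x s
  assume *: "X \<in> S" "x \<in> X" "s \<in> X \<rightarrow>\<^sub>E terms Q"
  then obtain \<sigma> where \<sigma>: "\<sigma> \<in> X \<rightarrow>\<^sub>E terms (fib0 C)" "s = class_map X \<sigma>"
    by (elim class_mapE)
  have "tsub Q X (vr A X x) (class_map X \<sigma>) = eq_rel C `` {\<sigma> x}"
    using * \<sigma>(1) Q_tsub[OF *(1) _ var_closed[OF *(1,2)] \<sigma>(1)] P3[OF *(1,2) \<sigma>(1)] by auto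
  then show "tsub Q X (vr A X x) s = s x"
    using *(2) \<sigma>(2) by (simp add: class_map_def)
next
  fix X s
  assume *: "X \<in> S" "X \<noteq> {}" "s \<in> X \<rightarrow>\<^sub>E terms Q"
  then obtain \<sigma> where \<sigma>: "\<sigma> \<in> X \<rightarrow>\<^sub>E terms (fib0 C)" "s = class_map X \<sigma>"
    by (elim class_mapE)
  interpret PrA: boolean_algebra_on "Pr A X"
    using * by (intro substitution_target.props_boolean[OF target])
  show "boolean_hom (Pr A X) (props Q) (\<lambda>p. psub Q X p s)"
    using P4[OF *(1,2) \<sigma>(1)] \<sigma> * by (simp add: boolean_hom_def Q_psub PrA.closed Pi_iff)
qed

lemma equality_quotient_equality_target: "equality_target S A Q"
proof (rule equality_target.intro)
  fix P R
  assume "P \<in> terms Q" "R \<in> terms Q"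
  then show "eql Q P R \<in> carrier (props Q)"
    by (auto elim!: quotientE simp: Q_eql eql_closed)
next
  fix X a b s
  assume "X \<in> S" "X \<noteq> {}" "a \<in> Tm A X" "b \<in> Tm A X" "s \<in> X \<rightarrow>\<^sub>E terms Q"
  moreover from this have "eql (fib A X) a b \<in> carrier (Pr A X)"
    by (intro equality_target.eql_closed[OF eq_target])
  ultimately show "psub Q X (eql (fib A X) a b) s = eql Q (tsub Q X a s) (tsub Q X b s)"
    by (elim class_mapE) (simp add: Q_tsub Q_psub Q_eql tsub_closed E1)
next
  fix P
  assume "P \<in> terms Q"
  then show "eql Q P P = bone (props Q)"
    by (auto elim!: quotientE simp: Q_eql E2)
qed

end

section \<open>Ultraproducts\<close>

locale ultraproduct = quantifier_theory_with_equality S A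
  for S :: "'v set set" and A :: "('v, 'a, 'p, 'b, 'q) qtheory" +
  fixes J :: "'i set"
    and Bi :: "'i \<Rightarrow> ('v, 'a, 'p, 'd, 'r) qtheory"
    and I :: "('i \<Rightarrow> 'r) set"
  assumes lf: "locally_finite S A"
    and normal_model: "\<And>i. i \<in> J \<Longrightarrow> normal_two_model_of S A (Bi i)"
    and ultra: "is_ultrafilter_of (props (fib0 (product_modification A J Bi))) I"
begin

abbreviation P :: "('v, 'a, 'p, 'i \<Rightarrow> 'd, 'i \<Rightarrow> 'r) fibre" where
  "P \<equiv> fib0 (product_modification A J Bi)"

abbreviation C :: "('v, 'a, 'p, 'i \<Rightarrow> 'd, ('i \<Rightarrow> 'r) set) qtheory" where
  "C \<equiv> filter_quotient (product_modification A J Bi) I"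

lemma factor_target: "i \<in> J \<Longrightarrow> substitution_target S A (fib0 (Bi i))"
  and factor_equality: "i \<in> J \<Longrightarrow> equality_target S A (fib0 (Bi i))"
  using normal_model modification_target unfolding normal_two_model_of_def by blast+

lemma factor_model: "i \<in> J \<Longrightarrow> two_model (insert {} S) (Bi i)"
  using normal_model by (simp add: normal_two_model_of_def)

text \<open>Normality gives the values one and zero; (M1) keeps them apart, so that value one forces
  equality.\<close>

lemma factor_eql_eq_one_iff:
  assumes "i \<in> J" "c \<in> terms (fib0 (Bi i))" "d \<in> terms (fib0 (Bi i))"
  shows "eql (fib0 (Bi i)) c d = bone (props (fib0 (Bi i))) \<longleftrightarrow> c = d"
  using assms normal_model[OF assms(1)]
    quantifier_model.M1_props[OF two_model.axioms(1)[OF factor_model]]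
  unfolding normal_two_model_of_def is_normal_def by metis

sublocale P: substitution_target S A P
  using factor_target by (rule product_substitution_target)

sublocale P: equality_target S A P
  using factor_equality by (rule product_equality_target)

sublocale U: ultrafilter_on "props P" I
  using ultra P.props_boolean by (simp add: ultrafilter_on_def ultrafilter_on_axioms_def)

lemma P_terms: "terms P = (\<Pi>\<^sub>E i\<in>J. terms (fib0 (Bi i)))"
  and P_props: "props P = product_balg J (\<lambda>i. props (fib0 (Bi i)))"
  and P_tsub: "i \<in> J \<Longrightarrow> tsub P X a \<sigma> i = tsub (fib0 (Bi i)) X a (\<lambda>x\<in>X. \<sigma> x i)"
  and P_psub: "i \<in> J \<Longrightarrow> psub P X p \<sigma> i = psub (fib0 (Bi i)) X p (\<lambda>x\<in>X. \<sigma> x i)"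
  and P_eql: "i \<in> J \<Longrightarrow> eql P c d i = eql (fib0 (Bi i)) (c i) (d i)"
  by (simp_all add: product_modification_def)

lemma P_carrier_component: "p \<in> carrier (props P) \<Longrightarrow> i \<in> J \<Longrightarrow> p i \<in> carrier (props (fib0 (Bi i)))"
  by (auto simp: P_props product_balg_def)

lemma P_eql_component:
  "i \<in> J \<Longrightarrow> c \<in> terms P \<Longrightarrow> d \<in> terms P \<Longrightarrow>
    eql P c d i = bone (props (fib0 (Bi i))) \<longleftrightarrow> c i = d i"
  by (simp add: P_eql, rule factor_eql_eq_one_iff) (auto simp: P_terms)

text \<open>Upward closure of \<open>I\<close> read on index sets: in two-valued factors
  \<open>m\<close> is below \<open>r\<close> as soon as \<open>r\<close> is one wherever
  \<open>m\<close> is.\<close>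

lemma mem_pointwise:
  assumes m: "m \<in> I" and r: "r \<in> carrier (props P)"
    and le: "\<And>i. i \<in> J \<Longrightarrow> m i = bone (props (fib0 (Bi i))) \<Longrightarrow> r i = bone (props (fib0 (Bi i)))"
  shows "r \<in> I"
proof (rule U.upward[OF m r])
  have "ble (props (fib0 (Bi i))) (m i) (r i)" if i: "i \<in> J" for i
  proof -
    interpret Bi: two_model "insert {} S" "Bi i"
      using i by (rule factor_model)
    interpret L: boolean_algebra_on "props (fib0 (Bi i))"
      using i by (intro substitution_target.props_boolean[OF factor_target])
    have "m i \<in> {bzero (props (fib0 (Bi i))), bone (props (fib0 (Bi i)))}"
      using P_carrier_component[OF U.mem_carrier[OF m] i] Bi.two_valued by simp
    then show ?thesis
      using le[OF i] P_carrier_component[OF r i] by (auto simp: L.ble_zero L.ble_refl)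
  qed
  then show "ble (props P) m r"
    using U.mem_carrier[OF m] by (simp add: P_props product_ble_iff)
qed

lemma meet_pointwise:
  assumes "m \<in> I" "n \<in> I"
  obtains k where "k \<in> I" "\<And>i. i \<in> J \<Longrightarrow> k i = bone (props (fib0 (Bi i))) \<Longrightarrow>
    m i = bone (props (fib0 (Bi i))) \<and> n i = bone (props (fib0 (Bi i)))"
proof
  show "bmeet (props P) m n \<in> I"
    using assms by (rule U.meet_mem)
  fix i
  assume i: "i \<in> J" and "bmeet (props P) m n i = bone (props (fib0 (Bi i)))"
  then have "bmeet (props (fib0 (Bi i))) (m i) (n i) = bone (props (fib0 (Bi i)))"
    by (simp add: P_props product_balg_def)
  then show "m i = bone (props (fib0 (Bi i))) \<and> n i = bone (props (fib0 (Bi i)))"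
    using boolean_algebra_on.meet_eq_oneD[OF substitution_target.props_boolean[OF factor_target[OF i]]]
      P_carrier_component[OF U.mem_carrier i] assms by blast
qed

text \<open>Closure under meets gives one member of \<open>I\<close> that forces all the agreements
  at once. This is where finiteness of the support is used, since the meet of infinitely many
  members may leave \<open>I\<close>.\<close>

lemma finite_agreement:
  assumes "finite V" "\<And>x. x \<in> V \<Longrightarrow> \<sigma> x \<in> terms P" "\<And>x. x \<in> V \<Longrightarrow> \<tau> x \<in> terms P"
    and "\<And>x. x \<in> V \<Longrightarrow> eql P (\<sigma> x) (\<tau> x) \<in> I"
  shows "\<exists>m\<in>I. \<forall>i\<in>J. m i = bone (props (fib0 (Bi i))) \<longrightarrow> (\<forall>x\<in>V. \<sigma> x i = \<tau> x i)"
  using assms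
proof (induction V)
  case empty
  then show ?case using U.one_mem by blast
next
  case (insert x V)
  then obtain m where m: "m \<in> I"
    "\<forall>i\<in>J. m i = bone (props (fib0 (Bi i))) \<longrightarrow> (\<forall>x\<in>V. \<sigma> x i = \<tau> x i)"
    by (metis insert_iff)
  have "eql P (\<sigma> x) (\<tau> x) \<in> I"
    using insert.prems by simp
  with m(1) obtain k where "k \<in> I" "\<And>i. i \<in> J \<Longrightarrow> k i = bone (props (fib0 (Bi i))) \<Longrightarrow>
    m i = bone (props (fib0 (Bi i))) \<and> eql P (\<sigma> x) (\<tau> x) i = bone (props (fib0 (Bi i)))"
    by (rule meet_pointwise) blast
  with m(2) insert.prems show ?case
    by (auto simp: P_eql_component intro!: bexI[of _ k])
qed

lemma C_simps:
  "terms (fib0 C) = terms P" "props (fib0 C) = quotient_balg (props P) I"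
  "tsub (fib0 C) = tsub P" "psub (fib0 C) X p \<sigma> = filter_rel (props P) I `` {psub P X p \<sigma>}"
  "eql (fib0 C) c d = filter_rel (props P) I `` {eql P c d}"
  by (simp_all add: filter_quotient_def)

lemma eq_rel_iff:
  "(c, d) \<in> eq_rel C \<longleftrightarrow> c \<in> terms P \<and> d \<in> terms P \<and> eql P c d \<in> I"
  by (simp add: eq_rel_def C_simps U.filter_class_eq_one_iff P.eql_closed cong: conj_cong)

lemma equiv_eq_rel: "equiv (terms P) (eq_rel C)"
proof (rule equivI)
  show "eq_rel C \<subseteq> terms P \<times> terms P"
    by (auto simp: eq_rel_iff)
  show "refl_on (terms P) (eq_rel C)"
    by (auto simp: refl_on_def eq_rel_iff P.E2 U.one_mem)
  show "sym (eq_rel C)"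
  proof (rule symI)
    fix c d
    assume "(c, d) \<in> eq_rel C"
    then show "(d, c) \<in> eq_rel C"
      using mem_pointwise[of "eql P c d" "eql P d c"]
      by (auto simp: eq_rel_iff P.eql_closed P_eql_component)
  qed
  show "trans (eq_rel C)"
  proof (rule transI)
    fix c d e
    assume *: "(c, d) \<in> eq_rel C" "(d, e) \<in> eq_rel C"
    then have "eql P c d \<in> I" "eql P d e \<in> I"
      by (simp_all add: eq_rel_iff)
    then obtain k where k: "k \<in> I" "\<And>i. i \<in> J \<Longrightarrow> k i = bone (props (fib0 (Bi i))) \<Longrightarrow>
      eql P c d i = bone (props (fib0 (Bi i))) \<and> eql P d e i = bone (props (fib0 (Bi i)))"
      by (rule meet_pointwise) blast
    then show "(c, e) \<in> eq_rel C"
      using * mem_pointwise[of k "eql P c e"]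
      by (auto simp: eq_rel_iff P.eql_closed P_eql_component)
  qed
qed

sublocale congruent_equality S A C
proof -
  \<comment> \<open>One implication suffices: classes are equal when membership in \<open>I\<close>
    is, and \<theta> is symmetric.\<close>
  have psub_mono: "psub P X p \<tau> \<in> I"
    if X: "X \<in> S" "X \<noteq> {}" and p: "p \<in> carrier (Pr A X)"
      and \<sigma>: "\<sigma> \<in> X \<rightarrow>\<^sub>E terms P" and \<tau>: "\<tau> \<in> X \<rightarrow>\<^sub>E terms P"
      and eq: "\<And>x. x \<in> X \<Longrightarrow> (\<sigma> x, \<tau> x) \<in> eq_rel C" and mem: "psub P X p \<sigma> \<in> I" for X p \<sigma> \<tau>
  proof -
    obtain V where V: "finite V" "V \<subseteq> X" and
      supp: "\<And>F :: ('v, 'a, 'p, 'd, 'r) fibre. substitution_target S A F \<Longrightarrow> supports_prop_in F X V p"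
      by (rule finite_support_any_target_prop[OF lf X p]) blast
    obtain m where m: "m \<in> I"
      "\<forall>i\<in>J. m i = bone (props (fib0 (Bi i))) \<longrightarrow> (\<forall>x\<in>V. \<sigma> x i = \<tau> x i)"
      using finite_agreement[OF V(1), of \<sigma> \<tau>] V(2) eq by (auto simp: eq_rel_iff)
    obtain k where k: "k \<in> I" "\<And>i. i \<in> J \<Longrightarrow> k i = bone (props (fib0 (Bi i))) \<Longrightarrow>
      m i = bone (props (fib0 (Bi i))) \<and> psub P X p \<sigma> i = bone (props (fib0 (Bi i)))"
      using m(1) mem by (rule meet_pointwise) blast
    show ?thesis
    proof (rule mem_pointwise[OF k(1) P.psub_closed[OF X p \<tau>]])
      fix i
      assume i: "i \<in> J" and "k i = bone (props (fib0 (Bi i)))"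
      then have "\<forall>x\<in>V. (\<lambda>x\<in>X. \<sigma> x i) x = (\<lambda>x\<in>X. \<tau> x i) x"
        and one: "psub P X p \<sigma> i = bone (props (fib0 (Bi i)))"
        using k(2) m(2) V(2) by auto
      then have "psub (fib0 (Bi i)) X p (\<lambda>x\<in>X. \<sigma> x i) = psub (fib0 (Bi i)) X p (\<lambda>x\<in>X. \<tau> x i)"
        using supp[OF factor_target[OF i]] product_component[OF \<sigma> i] product_component[OF \<tau> i]
        unfolding supports_prop_in_def by blast
      then show "psub P X p \<tau> i = bone (props (fib0 (Bi i)))"
        using one i by (simp add: P_psub)
    qed
  qed
  show "congruent_equality S A C"
  proof (intro congruent_equality.intro congruent_equality_axioms.intro
      quantifier_theory_with_equality_axioms)
    show "substitution_target S A (fib0 C)"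
      using P.substitution_target_axioms ultra by (rule filter_quotient_substitution_target)
    show "equality_target S A (fib0 C)"
      using P.substitution_target_axioms P.equality_target_axioms ultra
      by (rule filter_quotient_equality_target)
    show "equiv (terms (fib0 C)) (eq_rel C)"
      using equiv_eq_rel by (simp add: C_simps)
  next
    fix X a \<sigma> \<tau>
    assume X: "X \<in> S" "X \<noteq> {}" and a: "a \<in> Tm A X"
      and "\<sigma> \<in> X \<rightarrow>\<^sub>E terms (fib0 C)" "\<tau> \<in> X \<rightarrow>\<^sub>E terms (fib0 C)"
      and eq: "\<And>x. x \<in> X \<Longrightarrow> (\<sigma> x, \<tau> x) \<in> eq_rel C"
    then have \<sigma>: "\<sigma> \<in> X \<rightarrow>\<^sub>E terms P" and \<tau>: "\<tau> \<in> X \<rightarrow>\<^sub>E terms P"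
      by (simp_all add: C_simps)
    have closed: "tsub P X a \<sigma> \<in> terms P" "tsub P X a \<tau> \<in> terms P"
      using X a \<sigma> \<tau> by (simp_all add: P.tsub_closed)
    obtain V where V: "finite V" "V \<subseteq> X" and
      supp: "\<And>F :: ('v, 'a, 'p, 'd, 'r) fibre. substitution_target S A F \<Longrightarrow> supports_term_in F X V a"
      by (rule finite_support_any_target_term[OF lf X a]) blast
    obtain m where m: "m \<in> I"
      "\<forall>i\<in>J. m i = bone (props (fib0 (Bi i))) \<longrightarrow> (\<forall>x\<in>V. \<sigma> x i = \<tau> x i)"
      using finite_agreement[OF V(1), of \<sigma> \<tau>] V(2) eq by (auto simp: eq_rel_iff)
    have "eql P (tsub P X a \<sigma>) (tsub P X a \<tau>) \<in> I"
    proof (rule mem_pointwise[OF m(1) P.eql_closed[OF closed]])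
      fix i
      assume i: "i \<in> J" and "m i = bone (props (fib0 (Bi i)))"
      then have "\<forall>x\<in>V. (\<lambda>x\<in>X. \<sigma> x i) x = (\<lambda>x\<in>X. \<tau> x i) x"
        using m(2) V(2) by auto
      then have "tsub (fib0 (Bi i)) X a (\<lambda>x\<in>X. \<sigma> x i) = tsub (fib0 (Bi i)) X a (\<lambda>x\<in>X. \<tau> x i)"
        using supp[OF factor_target[OF i]] product_component[OF \<sigma> i] product_component[OF \<tau> i]
        unfolding supports_term_in_def by blast
      then show "eql P (tsub P X a \<sigma>) (tsub P X a \<tau>) i = bone (props (fib0 (Bi i)))"
        using i closed by (simp add: P_eql_component P_tsub)
    qed
    then show "(tsub (fib0 C) X a \<sigma>, tsub (fib0 C) X a \<tau>) \<in> eq_rel C"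
      using closed by (simp add: eq_rel_iff C_simps)
  next
    fix X p \<sigma> \<tau>
    assume *: "X \<in> S" "X \<noteq> {}" "p \<in> carrier (Pr A X)"
      and "\<sigma> \<in> X \<rightarrow>\<^sub>E terms (fib0 C)" "\<tau> \<in> X \<rightarrow>\<^sub>E terms (fib0 C)"
      and eq: "\<And>x. x \<in> X \<Longrightarrow> (\<sigma> x, \<tau> x) \<in> eq_rel C"
    then have \<sigma>\<tau>: "\<sigma> \<in> X \<rightarrow>\<^sub>E terms P" "\<tau> \<in> X \<rightarrow>\<^sub>E terms P"
      by (simp_all add: C_simps)
    have "(\<tau> x, \<sigma> x) \<in> eq_rel C" if "x \<in> X" for x
      using eq[OF that] equiv_eq_rel by (meson equivE symD)
    then have "psub P X p \<sigma> \<in> I \<longleftrightarrow> psub P X p \<tau> \<in> I"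
      using psub_mono[OF * \<sigma>\<tau> eq] psub_mono[OF * \<sigma>\<tau>(2,1)] by blast
    then show "psub (fib0 C) X p \<sigma> = psub (fib0 C) X p \<tau>"
      using * \<sigma>\<tau> by (simp add: C_simps U.filter_class_eq_iff P.psub_closed)
  next
    fix c c' d d'
    assume *: "(c, c') \<in> eq_rel C" "(d, d') \<in> eq_rel C"
    \<comment> \<open>An equality lies in \<open>I\<close> exactly when its two arguments are
      \<theta>-related, so compatibility of \<open>eql\<close> with \<theta> is symmetry and
      transitivity of \<theta>.\<close>
    then have "(c, d) \<in> eq_rel C \<longleftrightarrow> (c', d') \<in> eq_rel C"
      using equiv_eq_rel by (meson equivE symD transD)
    then show "eql (fib0 C) c d = eql (fib0 C) c' d'"
      using * by (simp add: eq_rel_iff C_simps U.filter_class_eq_iff P.eql_closed)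
  qed
qed

section \<open>Quantifiers in the product and in the ultraproduct\<close>

lemma P_forall_attained:
  assumes X: "X \<in> S" and x: "x \<in> X" and p: "p \<in> carrier (Pr A X)" and \<sigma>: "\<sigma> \<in> X \<rightarrow>\<^sub>E terms P"
  shows "\<exists>d\<in>terms P. psub P X p (\<sigma>(x := d)) = psub P X (allq A X x p) \<sigma>"
    and "\<And>d. d \<in> terms P \<Longrightarrow> ble (props P) (psub P X (allq A X x p) \<sigma>) (psub P X p (\<sigma>(x := d)))"
proof -
  let ?\<sigma> = "\<lambda>i. \<lambda>y\<in>X. \<sigma> y i"
  have ne: "X \<noteq> {}" using x by auto
  have inf: "is_infimum (props (fib0 (Bi i)))
      ((\<lambda>e. psub (fib0 (Bi i)) X p ((?\<sigma> i)(x := e))) ` terms (fib0 (Bi i)))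
      (psub (fib0 (Bi i)) X (allq A X x p) (?\<sigma> i))" if i: "i \<in> J" for i
  proof -
    interpret Bi: two_model "insert {} S" "Bi i"
      using i by (rule factor_model)
    \<comment> \<open>(M2) speaks of the quantifier of \<open>Bi i\<close>, which agrees with that
      of \<open>A\<close> at \<open>x\<close> and \<open>p\<close>.\<close>
    have "same_restriction S A (Bi i)"
      using normal_model[OF i] by (simp add: normal_two_model_of_def modification_def)
    then have "carrier (Pr (Bi i) X) = carrier (Pr A X)" "allq (Bi i) X x p = allq A X x p"
      using X ne x p by (auto simp: same_restriction_def same_balg_def)
    then show ?thesis
      using Bi.M2[of X x p "?\<sigma> i"] X x p product_component[OF \<sigma> i] by simp
  qed
  have upd: "(\<lambda>y\<in>X. (\<sigma>(x := d)) y i) = (?\<sigma> i)(x := d i)" for d i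
    using x by auto
  have upd_closed: "(?\<sigma> i)(x := e) \<in> X \<rightarrow>\<^sub>E terms (fib0 (Bi i))"
    if "i \<in> J" "e \<in> terms (fib0 (Bi i))" for i e
    using product_component[OF \<sigma> that(1)] that(2) x by (auto simp: PiE_iff extensional_def)
  have "\<exists>e\<in>terms (fib0 (Bi i)). psub (fib0 (Bi i)) X p ((?\<sigma> i)(x := e)) =
      psub (fib0 (Bi i)) X (allq A X x p) (?\<sigma> i)" if i: "i \<in> J" for i
  proof -
    interpret Bi: two_model "insert {} S" "Bi i"
      using i by (rule factor_model)
    interpret T: substitution_target S A "fib0 (Bi i)"
      using i by (rule factor_target)
    have "psub (fib0 (Bi i)) X (allq A X x p) (?\<sigma> i) \<in>
        (\<lambda>e. psub (fib0 (Bi i)) X p ((?\<sigma> i)(x := e))) ` terms (fib0 (Bi i))"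
      using Bi.M1_terms T.psub_closed[OF X ne p upd_closed[OF i]]
      by (intro boolean_algebra_on.two_valued_infimum_attained[OF T.props_boolean Bi.two_valued
            Bi.M1_props _ _ inf[OF i]]) auto
    then show ?thesis by auto
  qed
  \<comment> \<open>The witnesses are chosen independently in the factors; they form one term
    because \<open>terms P\<close> is the full product.\<close>
  then obtain e where e: "\<And>i. i \<in> J \<Longrightarrow> e i \<in> terms (fib0 (Bi i))"
    "\<And>i. i \<in> J \<Longrightarrow> psub (fib0 (Bi i)) X p ((?\<sigma> i)(x := e i)) =
      psub (fib0 (Bi i)) X (allq A X x p) (?\<sigma> i)"
    by metis
  show "\<exists>d\<in>terms P. psub P X p (\<sigma>(x := d)) = psub P X (allq A X x p) \<sigma>"
  proof
    show "restrict e J \<in> terms P"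
      using e(1) by (simp add: P_terms)
    have "psub (fib0 (Bi i)) X p (\<lambda>y\<in>X. (\<sigma>(x := restrict e J)) y i) =
        psub (fib0 (Bi i)) X (allq A X x p) (?\<sigma> i)" if "i \<in> J" for i
      unfolding upd using e(2) that by simp
    then show "psub P X p (\<sigma>(x := restrict e J)) = psub P X (allq A X x p) \<sigma>"
      by (simp add: product_modification_def cong: restrict_cong)
  qed
  fix d
  assume d: "d \<in> terms P"
  have "psub P X (allq A X x p) \<sigma> \<in> carrier (props P)"
    using allq_closed[OF X x p] P.psub_closed[OF X ne _ \<sigma>] by blast
  moreover have "ble (props (fib0 (Bi i))) (psub P X (allq A X x p) \<sigma> i) (psub P X p (\<sigma>(x := d)) i)"
    if i: "i \<in> J" for i
    unfolding P_psub[OF i] upd using inf[OF i] d i by (auto simp: is_infimum_def P_terms)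
  ultimately show "ble (props P) (psub P X (allq A X x p) \<sigma>) (psub P X p (\<sigma>(x := d)))"
    by (simp add: P_props product_ble_iff)
qed

text \<open>Changing \<open>s\<close> at \<open>x\<close> to a class is lifted by changing
  \<open>\<sigma>\<close> at \<open>x\<close> to a representative. So the values over all classes
  are the images of the values in the product, and the class map carries over both the order and the
  witness.\<close>

lemma Q_forall_infimum:
  assumes X: "X \<in> S" and x: "x \<in> X" and p: "p \<in> carrier (Pr A X)" and s: "s \<in> X \<rightarrow>\<^sub>E terms Q"
  shows "is_infimum (props Q) ((\<lambda>c. psub Q X p (s(x := c))) ` terms Q) (psub Q X (allq A X x p) s)"
proof -
  have ne: "X \<noteq> {}" using x by auto
  obtain \<sigma> where \<sigma>C: "\<sigma> \<in> X \<rightarrow>\<^sub>E terms (fib0 C)" and s_eq: "s = class_map X \<sigma>"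
    using s by (rule class_mapE)
  then have \<sigma>: "\<sigma> \<in> X \<rightarrow>\<^sub>E terms P"
    by (simp add: C_simps)
  let ?h = "\<lambda>r. filter_rel (props P) I `` {r}"
  have \<sigma>d: "\<sigma>(x := d) \<in> X \<rightarrow>\<^sub>E terms P" if "d \<in> terms P" for d
    using \<sigma> x that by (auto simp: PiE_iff extensional_def)
  have at_class: "psub Q X p (s(x := eq_rel C `` {d})) = ?h (psub P X p (\<sigma>(x := d)))"
    if d: "d \<in> terms P" for d
  proof -
    have "s(x := eq_rel C `` {d}) = class_map X (\<sigma>(x := d))"
      using x by (simp add: s_eq class_map_def fun_eq_iff)
    then show ?thesis
      using Q_psub[OF X ne p, of "\<sigma>(x := d)"] \<sigma>d[OF d] by (simp add: C_simps)
  qed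
  have forall: "psub Q X (allq A X x p) s = ?h (psub P X (allq A X x p) \<sigma>)"
    using Q_psub[OF X ne allq_closed[OF X x p] \<sigma>C] by (simp add: s_eq C_simps)
  have closed: "psub P X (allq A X x p) \<sigma> \<in> carrier (props P)"
    by (intro P.psub_closed X ne allq_closed x p \<sigma>)
  obtain d where d: "d \<in> terms P" "psub P X p (\<sigma>(x := d)) = psub P X (allq A X x p) \<sigma>"
    using P_forall_attained(1)[OF X x p \<sigma>] by blast
  show ?thesis
    unfolding Q_props
  proof (rule boolean_algebra_on.is_infimum_attained)
    show "boolean_algebra_on (props (fib0 C))"
      by (simp add: C_simps U.quotient_boolean_algebra)
    show "psub Q X (allq A X x p) s \<in> carrier (props (fib0 C))"
      using closed by (simp add: forall C_simps U.filter_class_closed)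
    show "psub Q X (allq A X x p) s \<in> (\<lambda>c. psub Q X p (s(x := c))) ` terms Q"
      using d(1) by (intro image_eqI[of _ _ "eq_rel C `` {d}"])
        (simp_all add: forall at_class d C_simps quotientI)
    fix r
    assume "r \<in> (\<lambda>c. psub Q X p (s(x := c))) ` terms Q"
    then obtain d' where d': "d' \<in> terms P" "r = ?h (psub P X p (\<sigma>(x := d')))"
      by (auto elim!: quotientE simp: C_simps at_class)
    show "ble (props (fib0 C)) (psub Q X (allq A X x p) s) r"
      unfolding forall d'(2) C_simps
      by (intro boolean_hom_ble[OF U.filter_class_hom] closed P.psub_closed X ne p \<sigma>d d'
          P_forall_attained(2) x \<sigma>)
  qed
qed

lemma normal_two_model: "normal_two_model_of S A (equality_quotient C)"
proof -
  \<comment> \<open>The nested replacements of the fibre at the empty set collapse to a single one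
    in \<open>A\<close>.\<close>
  have D: "equality_quotient C = with_fib0 A Q"
    by (simp add: equality_quotient_def filter_quotient_def product_modification_def with_fib0_def)
  have mod: "modification S A (equality_quotient C)"
    by (subst D, intro modification_with_fib0 equality_quotient_substitution_target
        equality_quotient_equality_target)
  have D_simps: "Pr (equality_quotient C) X = Pr A X"
    "allq (equality_quotient C) X = allq A X" for X
    by (subst D, simp)+
  have "terms P \<noteq> {}"
    using quantifier_model.M1_terms[OF two_model.axioms(1)[OF factor_model]]
    by (simp add: P_terms PiE_eq_empty_iff)
  then have "terms Q \<noteq> {}"
    by (simp add: C_simps quotient_def)
  moreover have "quantifier_theory (insert {} S) (equality_quotient C)"
    using mod by (simp add: modification_def quantifier_theory_with_equality_def)
  moreover have "is_infimum (props Q) ((\<lambda>d. psub Q X p (\<sigma>(x := d))) ` terms Q)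
      (psub Q X (allq (equality_quotient C) X x p) \<sigma>)"
    if "X \<in> insert {} S" "x \<in> X" "p \<in> carrier (Pr (equality_quotient C) X)"
      "\<sigma> \<in> X \<rightarrow>\<^sub>E terms Q" for X x p \<sigma>
    unfolding D_simps using that by (intro Q_forall_infimum) (auto simp: D_simps)
  ultimately have "two_model (insert {} S) (equality_quotient C)"
    using U.quotient_two_valued U.quotient_zero_neq_one
    by (intro two_model.intro two_model_axioms.intro quantifier_model.intro
        quantifier_model_axioms.intro) (simp_all add: C_simps(2))
  moreover have "is_normal (equality_quotient C)"
    unfolding is_normal_def
  proof (intro ballI conjI impI)
    fix c
    assume "c \<in> terms Q"
    then show "eql Q c c = bone (props Q)"
      by (rule equality_target.E2[OF equality_quotient_equality_target])
  next
    fix c d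
    assume "c \<in> terms Q" "d \<in> terms Q" and ne: "c \<noteq> d"
    then obtain c' d' where cd: "c' \<in> terms P" "d' \<in> terms P"
      "c = eq_rel C `` {c'}" "d = eq_rel C `` {d'}"
      by (auto simp: C_simps elim!: quotientE)
    \<comment> \<open>Distinct classes have unrelated representatives, so their equality is not one;
      the quotient by an ultrafilter leaves zero as the only other value.\<close>
    then have "eql P c' d' \<notin> I"
      using ne equiv_class_eq[OF equiv_eq_rel] eq_rel_iff by blast
    then show "eql Q c d = bzero (props Q)"
      using cd Q_eql[of c' d'] by (simp add: C_simps U.filter_class_eq_zero_iff P.eql_closed)
  qed
  ultimately show ?thesis
    using mod by (simp add: normal_two_model_of_def)
qed

end

theorem theorem36:
  fixes S :: "'v set set"
    and A :: "('v, 'a, 'p, 'b, 'q) qtheory"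
    and J :: "'i set"
    and Bi :: "'i \<Rightarrow> ('v, 'a, 'p, 'd, 'r) qtheory"
    and B :: "('v, 'a, 'p, 'i \<Rightarrow> 'd, 'i \<Rightarrow> 'r) qtheory"
    and I :: "('i \<Rightarrow> 'r) set"
  assumes "J \<noteq> {}"
    and "quantifier_theory_with_equality S A"
    and "locally_finite S A"
    and "\<And>i. i \<in> J \<Longrightarrow> normal_two_model_of S A (Bi i)"
    and "B = product_modification A J Bi"
    and "is_ultrafilter_of (props (fib0 B)) I"
  shows "normal_two_model_of S A (equality_quotient (filter_quotient B I))"
proof -
  have "ultraproduct S A J Bi I"
    using assms by (simp add: ultraproduct_def ultraproduct_axioms_def)
  then show ?thesis
    using assms(5) by (simp add: ultraproduct.normal_two_model)
qed

end
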